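(* Let $m$ be a positive integer, let $t\ge 0$ be an integer, and let $\{(A_i,B_i)\}_{i=1}^m$ be a collection of pairs of subspaces of a finite dimensional real vector space, with $\dim(A_i)=a_i$ and $\dim(B_i)=b_i$, where $a_i\le b_i$ for every $1\le i\le m$. Suppose that \begin{itemize} \item $\dim(A_i\cap A_j)>t$ for all $1\le i,j\le m$ (including $i=j$), \item $\dim(A_i\cap B_i)\le t$ for all $1\le i\le m$, \item $\dim(A_i\cap B_j)>t$ for all $1\le i<j\le m$, \item $a_i+b_i=N$ for all $1\le i\le m$ and some positive integer $N$, and $a_1\le a_2\le\cdots\le a_m$. \end{itemize} Then $$\sum_{i=1}^m \binom{N-(2t+1)}{a_i-(t+1)}^{-1}\le 1.$$ Moreover, when $a_i<b_i$ for every $1\le i\le m$, equality holds only if $a_1=a_2=\cdots=a_m$ and $b_1=b_2=\cdots=b_m$. *)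

theory Defs
  imports "HOL-Analysis.Analysis"
begin

end

theory Submission
  imports Defs "HOL-Library.Nat_Bijection"
begin

text \<open>Intersecting everything with the common kernel of \<open>t\<close> generic functionals reduces the
  theorem to the case \<open>t = 0\<close> with \<open>N - 2 t\<close> in place of \<open>N\<close>, and \<open>N - 2 t\<close> further generic
  functionals map all subspaces into a space of exactly that dimension, injectively on each
  \<open>A\<^sub>i + B\<^sub>i\<close>. In its exterior algebra the multivectors \<open>\<alpha>\<^sub>i\<close>, \<open>\<beta>\<^sub>i\<close> of \<open>A\<^sub>i\<close>, \<open>B\<^sub>i\<close> satisfy
  \<open>\<alpha>\<^sub>i \<and> \<alpha>\<^sub>j = 0\<close>, \<open>\<alpha>\<^sub>i \<and> \<beta>\<^sub>i \<noteq> 0\<close>, and \<open>\<alpha>\<^sub>i \<and> \<beta>\<^sub>j = 0\<close> for \<open>i < j\<close>. Hence \<open>\<alpha>\<^sub>i\<close> is not in the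
  ideal generated by its predecessors, and reducing it modulo this ideal gives a form with a
  new leading monomial \<open>S\<^sub>i\<close>. Leading monomials are multiplicative, so the sets \<open>S\<^sub>i\<close> form an
  intersecting antichain with \<open>|S\<^sub>i| = a\<^sub>i - t\<close>, to which Katona's cycle method applies: on a
  cycle, an intersecting antichain of arcs of at most half length has no more members than the
  length of any one of them.\<close>

subsection \<open>Intersecting antichains\<close>

text \<open>The last disjunct is the part of the arc that wraps past \<open>N - 1\<close>. Spelled
  out without \<open>mod\<close>, membership is a linear condition on naturals.\<close>

definition cyc_arc :: "nat \<Rightarrow> nat \<Rightarrow> nat \<Rightarrow> nat set" where
  "cyc_arc N p k = {x. x < N \<and> (p \<le> x \<and> x < p + k \<or> x + N < p + k)}"

lemma cyc_arc_subset: "cyc_arc N p k \<subseteq> {..<N}"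
  by (auto simp: cyc_arc_def)

lemma card_cyc_arc:
  assumes "p < N" "k \<le> N"
  shows "card (cyc_arc N p k) = k"
proof -
  have "cyc_arc N p k = {p..<min N (p + k)} \<union> {..<p + k - N}"
    using assms by (auto simp: cyc_arc_def)
  moreover have "card ({p..<min N (p + k)} \<union> {..<p + k - N}) = (min N (p + k) - p) + (p + k - N)"
    using assms by (subst card_Un_disjoint) auto
  ultimately show ?thesis
    using assms by auto
qed

text \<open>Each start lies in the arc of the other, so if they differed, a full turn from
  \<open>p\<close> to \<open>q\<close> and back would take fewer than \<open>2 * k\<close>
  steps.\<close>

lemma cyc_arc_start_inj:
  assumes "cyc_arc N p k = cyc_arc N q k" "p < N" "q < N" "0 < k" "2 * k \<le> N"
  shows "p = q"
proof -
  have "p \<in> cyc_arc N p k" "q \<in> cyc_arc N q k"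
    using assms(2-4) by (auto simp: cyc_arc_def)
  then have "p \<in> cyc_arc N q k" "q \<in> cyc_arc N p k"
    using assms(1) by simp_all
  then show ?thesis
    using assms(2-) by (auto simp: cyc_arc_def)
qed

text \<open>Every arc of the family other than the base arc starts inside the base arc or ends inside it
  before its last point. Two arcs of which one ends immediately before the other starts are
  disjoint, as their lengths add up to at most \<open>N\<close>, so each gap of the base arc accounts for at most
  one arc.\<close>

lemma card_cyc_arcs_le:
  fixes Q :: "(nat \<times> nat) set"
  assumes bnd: "\<And>p k. (p, k) \<in> Q \<Longrightarrow> p < N \<and> 2 * k \<le> N"
    and int: "\<And>p k q l. (p, k) \<in> Q \<Longrightarrow> (q, l) \<in> Q \<Longrightarrow> cyc_arc N p k \<inter> cyc_arc N q l \<noteq> {}"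
    and anti: "\<And>p k q l. (p, k) \<in> Q \<Longrightarrow> (q, l) \<in> Q \<Longrightarrow> cyc_arc N p k \<subseteq> cyc_arc N q l \<Longrightarrow> (p, k) = (q, l)"
    and base: "(p0, k0) \<in> Q"
  shows "card Q \<le> k0"
proof -
  \<comment> \<open>\<open>d p\<close> is the distance from \<open>p0\<close> forward to
    \<open>p\<close>. Gap \<open>i\<close> lies in front of the point at distance \<open>i\<close>,
    and \<open>g\<close> is the gap just before an arc that starts inside the base arc, otherwise
    the gap just after the arc; the base arc itself takes gap 0.\<close>
  define d where "d p = (if p0 \<le> p then p - p0 else p + N - p0)" for p
  define g where "g = (\<lambda>(p, k). if d p < k0 then d p else d p + k - N)"
  have p0: "p0 < N" "2 * k0 \<le> N" using bnd[OF base] by auto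
  have k0: "k0 > 0" using int[OF base base] p0 by (auto simp: cyc_arc_def)
  \<comment> \<open>An arc starting outside the base arc can meet it only by running past
    \<open>p0\<close>, and it stops before the last point of the base arc, which it would otherwise
    contain.\<close>
  have later: "N < d p + k \<and> d p + k - N < k0" if pk: "(p, k) \<in> Q" "\<not> d p < k0" for p k
  proof -
    have b: "p < N" "2 * k \<le> N" using bnd[OF pk(1)] by auto
    have ne: "p \<noteq> p0" using pk(2) k0 by (auto simp: d_def)
    obtain x where x: "x \<in> cyc_arc N p0 k0" "x \<in> cyc_arc N p k"
      using int[OF base pk(1)] by auto
    have 1: "N < d p + k"
      using x b p0 pk(2) by (auto simp: cyc_arc_def d_def split: if_splits)
    have "\<not> cyc_arc N p0 k0 \<subseteq> cyc_arc N p k" using anti[OF base pk(1)] ne by auto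
    then obtain y where y: "y \<in> cyc_arc N p0 k0" "y \<notin> cyc_arc N p k" by auto
    have "d p + k - N < k0"
      using y b p0 pk(2) 1 by (auto simp: cyc_arc_def d_def split: if_splits)
    with 1 show ?thesis by simp
  qed
  have mixed: False if pk: "(p, k) \<in> Q" "(q, l) \<in> Q" "d q + l - N = d p" "N < d q + l" for p k q l
  proof -
    have b: "p < N" "2 * k \<le> N" "q < N" "2 * l \<le> N" using bnd pk by auto
    obtain x where x: "x \<in> cyc_arc N p k" "x \<in> cyc_arc N q l"
      using int[OF pk(1,2)] by auto
    show False using x b p0 pk(3,4) by (auto simp: cyc_arc_def d_def split: if_splits)
  qed
  have d_inj: "p = q" if "d p = d q" "p < N" "q < N" for p q
    using that p0 by (auto simp: d_def split: if_splits)
  have start: "k = l" if pk: "(p, k) \<in> Q" "(p, l) \<in> Q" for p k l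
  proof -
    have "cyc_arc N p k \<subseteq> cyc_arc N p l \<or> cyc_arc N p l \<subseteq> cyc_arc N p k"
      by (cases "k \<le> l") (auto simp: cyc_arc_def)
    then show ?thesis using anti pk by blast
  qed
  have same_end: "(p, k) = (q, l)" if pk: "(p, k) \<in> Q" "(q, l) \<in> Q" "d p + k = d q + l" for p k q l
  proof -
    have b: "p < N" "2 * k \<le> N" "q < N" "2 * l \<le> N" using bnd pk by auto
    have "cyc_arc N p k \<subseteq> cyc_arc N q l" if "k \<le> l"
      using that b p0 pk(3) by (auto simp: cyc_arc_def d_def split: if_splits)
    moreover have "cyc_arc N q l \<subseteq> cyc_arc N p k" if "l \<le> k"
      using that b p0 pk(3) by (auto simp: cyc_arc_def d_def split: if_splits)
    ultimately show ?thesis using anti pk by (metis nat_le_linear)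
  qed
  have "inj_on g Q"
  proof (rule inj_onI, clarify)
    fix p k q l
    assume pk: "(p, k) \<in> Q" "(q, l) \<in> Q" "g (p, k) = g (q, l)"
    have b: "p < N" "q < N" using bnd pk by auto
    consider "d p < k0" "d q < k0" | "d p < k0" "\<not> d q < k0" | "\<not> d p < k0" "d q < k0"
      | "\<not> d p < k0" "\<not> d q < k0" by blast
    then show "p = q \<and> k = l"
    proof cases
      case 1
      then have "p = q" using pk(3) d_inj b by (simp add: g_def)
      then show ?thesis using pk(1,2) start by blast
    next
      case 2
      then show ?thesis using pk mixed[OF pk(1,2)] later[OF pk(2)] by (auto simp: g_def)
    next
      case 3
      then show ?thesis using pk mixed[OF pk(2,1)] later[OF pk(1)] by (auto simp: g_def)
    next
      case 4
      then show ?thesis using pk same_end[OF pk(1,2)] later[OF pk(1)] later[OF pk(2)]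
        by (auto simp: g_def)
    qed
  qed
  moreover have "g ` Q \<subseteq> {..<k0}"
    using later by (auto simp: g_def)
  ultimately show ?thesis
    using card_inj_on_le[of g Q "{..<k0}"] by simp
qed

section \<open>Permutations with prescribed images of sets\<close>

lemma exists_permutes_image2:
  assumes fin: "finite A" and sub: "X \<subseteq> A" "Y \<subseteq> A" "S \<subseteq> A" "T \<subseteq> A"
    and c: "card X = card S" "card Y = card T" "card (X \<inter> Y) = card (S \<inter> T)"
  shows "\<exists>\<pi>. \<pi> permutes A \<and> \<pi> ` X = S \<and> \<pi> ` Y = T"
proof -
  \<comment> \<open>Label each point by its membership in the two sets. The three cardinalities
    determine the sizes of all four cells, so both labellings have the same multiset of labels and
    differ by a permutation.\<close>
  define f where "f X Y x = (x \<in> X, x \<in> Y)" for X Y :: "'a set" and x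
  have fib: "card {x\<in>A. f X Y x = z} = (case z of
      (True, True) \<Rightarrow> card (X \<inter> Y) | (True, False) \<Rightarrow> card X - card (X \<inter> Y)
    | (False, True) \<Rightarrow> card Y - card (X \<inter> Y) | (False, False) \<Rightarrow> card A - (card X + card Y - card (X \<inter> Y)))"
    if "X \<subseteq> A" "Y \<subseteq> A" for X Y z
  proof -
    have fi: "finite X" "finite Y" using that fin finite_subset by auto
    obtain z1 z2 where z: "z = (z1, z2)" by (cases z)
    have 1: "{x\<in>A. x \<in> X \<and> x \<in> Y} = X \<inter> Y" "{x\<in>A. x \<in> X \<and> x \<notin> Y} = X - X \<inter> Y"
      "{x\<in>A. x \<notin> X \<and> x \<in> Y} = Y - X \<inter> Y" "{x\<in>A. x \<notin> X \<and> x \<notin> Y} = A - (X \<union> Y)"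
      using that by auto
    have 2: "card (X - X \<inter> Y) = card X - card (X \<inter> Y)" "card (Y - X \<inter> Y) = card Y - card (X \<inter> Y)"
      using fi by (auto intro!: card_Diff_subset)
    have 3: "card (A - (X \<union> Y)) = card A - card (X \<union> Y)"
      using fi that by (intro card_Diff_subset) auto
    have 4: "card (X \<union> Y) = card X + card Y - card (X \<inter> Y)"
      using card_Un_Int[OF fi] by simp
    show ?thesis
      by (cases z1; cases z2) (simp_all add: z f_def 1 2 3 4)
  qed
  have "image_mset (f X Y) (mset_set A) = image_mset (f S T) (mset_set A)"
  proof (rule multiset_eqI)
    fix z
    have "card {x\<in>A. f X Y x = z} = card {x\<in>A. f S T x = z}"
      unfolding fib[OF sub(1,2)] fib[OF sub(3,4)] c ..
    then show "count (image_mset (f X Y) (mset_set A)) z = count (image_mset (f S T) (mset_set A)) z"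
      using fin by (simp add: count_image_mset vimage_def Int_def conj_commute)
  qed
  from image_mset_eq_implies_permutes[OF fin this]
  obtain \<pi> where \<pi>: "\<pi> permutes A" "\<forall>x\<in>A. f X Y x = f S T (\<pi> x)" by blast
  have img: "\<pi> ` Z = W" if "Z \<subseteq> A" "W \<subseteq> A" "\<And>x. x \<in> A \<Longrightarrow> x \<in> Z \<longleftrightarrow> \<pi> x \<in> W" for Z W
  proof -
    have "W \<subseteq> \<pi> ` A" using that(2) permutes_image[OF \<pi>(1)] by simp
    then show ?thesis using that by blast
  qed
  have "\<pi> ` X = S" using \<pi>(2) by (intro img sub) (simp add: f_def)
  moreover have "\<pi> ` Y = T" using \<pi>(2) by (intro img sub) (simp add: f_def)
  ultimately show ?thesis using \<pi>(1) by blast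
qed

text \<open>The permutations are partitioned by the image of \<open>X\<close>, and composing with a
  permutation that takes \<open>T\<close> to \<open>T'\<close> shows that all classes have the same
  size.\<close>

lemma card_permutes_image:
  assumes fin: "finite A" and sub: "X \<subseteq> A" "S \<subseteq> A" and c: "card X = card S"
  shows "card {\<pi>. \<pi> permutes A \<and> \<pi> ` X = S} * (card A choose card S) = fact (card A)"
proof -
  define P where "P S = {\<pi>. \<pi> permutes A \<and> \<pi> ` X = S}" for S
  define K where "K = {T. T \<subseteq> A \<and> card T = card S}"
  have finP: "finite {\<pi>. \<pi> permutes A}" using fin by (rule finite_permutations)
  have le: "card (P T) \<le> card (P T')" if "T \<in> K" "T' \<in> K" for T T'
  proof -
    have "T \<subseteq> A" "T' \<subseteq> A" "card T = card T'" using that by (simp_all add: K_def)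
    then obtain \<sigma> where \<sigma>: "\<sigma> permutes A" "\<sigma> ` T = T'"
      using exists_permutes_image2[OF fin, of T "{}" T' "{}"] by auto
    have "inj_on ((\<circ>) \<sigma>) (P T)"
      using permutes_inj[OF \<sigma>(1)] by (auto simp: inj_on_def fun_eq_iff)
    moreover have "(\<circ>) \<sigma> ` P T \<subseteq> P T'"
      using \<sigma> by (auto simp: P_def permutes_compose image_comp[symmetric])
    moreover have "finite (P T')" using finP by (rule finite_subset[rotated]) (auto simp: P_def)
    ultimately show ?thesis by (rule card_inj_on_le)
  qed
  have SK: "S \<in> K" using sub by (simp add: K_def)
  have fK: "finite K" using fin by (simp add: K_def)
  have "fact (card A) = card {\<pi>. \<pi> permutes A}"
    using card_permutations[OF refl fin] by simp
  also have "{\<pi>. \<pi> permutes A} = (\<Union>T\<in>K. P T)"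
  proof -
    have "\<pi> ` X \<in> K" if "\<pi> permutes A" for \<pi>
    proof -
      have "card (\<pi> ` X) = card X"
        using permutes_inj[OF that] by (meson card_image inj_on_subset subset_UNIV)
      moreover have "\<pi> ` X \<subseteq> A" using permutes_image[OF that] sub by blast
      ultimately show ?thesis using c by (simp add: K_def)
    qed
    then show ?thesis by (auto simp: P_def)
  qed
  also have "card \<dots> = (\<Sum>T\<in>K. card (P T))"
    using finP by (intro card_UN_disjoint fK) (auto simp: P_def intro: finite_subset[rotated])
  also have "\<dots> = (\<Sum>T\<in>K. card (P S))"
    using le SK by (intro sum.cong) (auto intro!: antisym)
  also have "\<dots> = card (P S) * card K" by simp
  also have "card K = card A choose card S"
    using n_subsets[OF fin] by (simp add: K_def)
  finally show ?thesis by (simp add: P_def)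
qed

text \<open>Double counting of permutations and arcs, where a hit of \<open>S\<close> weighs
  \<open>1 / card S\<close>. For one permutation the number of hits is at most the size of any set
  hit, so the weights sum to at most 1; over all permutations \<open>S\<close> collects
  \<open>fact N\<close> times its summand. If two sizes differ, some permutation puts both sets on
  arcs, and its total is strictly below 1.\<close>

theorem intersecting_antichain_sum_le:
  fixes G :: "nat set set"
  assumes sub: "\<And>S. S \<in> G \<Longrightarrow> S \<subseteq> {..<N} \<and> 2 * card S \<le> N"
    and int: "\<And>S T. S \<in> G \<Longrightarrow> T \<in> G \<Longrightarrow> S \<inter> T \<noteq> {}"
    and anti: "\<And>S T. S \<in> G \<Longrightarrow> T \<in> G \<Longrightarrow> S \<subseteq> T \<Longrightarrow> S = T"
  shows "(\<Sum>S\<in>G. 1 / real ((N - 1) choose (card S - 1))) \<le> 1"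
    and "(\<Sum>S\<in>G. 1 / real ((N - 1) choose (card S - 1))) = 1 \<Longrightarrow>
      S \<in> G \<Longrightarrow> T \<in> G \<Longrightarrow> card S = card T"
proof -
  have finG: "finite G" using sub by (intro finite_subset[of G "Pow {..<N}"]) auto
  have finS: "finite S" if "S \<in> G" for S using sub[OF that] finite_subset by blast
  have pos: "card S > 0" if "S \<in> G" for S
    using int[OF that that] finS[OF that] by (auto simp: card_gt_0_iff)
  define Perm where "Perm = {\<pi>. \<pi> permutes {..<N}}"
  have finP: "finite Perm" unfolding Perm_def by (rule finite_permutations) simp
  define hits where "hits \<pi> p S \<longleftrightarrow> \<pi> ` cyc_arc N p (card S) = S" for \<pi> :: "nat \<Rightarrow> nat" and p S
  define Q where "Q \<pi> = {(p, S). p < N \<and> S \<in> G \<and> hits \<pi> p S}" for \<pi>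
  have finQ: "finite (Q \<pi>)" for \<pi>
    by (rule finite_subset[of _ "{..<N} \<times> G"]) (auto simp: Q_def finG)
  have cardQ: "card (Q \<pi>) \<le> card S" if \<pi>: "\<pi> \<in> Perm" and pS: "(p, S) \<in> Q \<pi>" for \<pi> p S
  proof -
    have inj: "inj \<pi>" using \<pi> permutes_inj by (auto simp: Perm_def)
    define h where "h = (\<lambda>(p :: nat, S :: nat set). (p, card S))"
    have "S = T" if "hits \<pi> p S" "hits \<pi> p T" "card S = card T" for p S T
      using that unfolding hits_def by metis
    then have "inj_on h (Q \<pi>)" by (auto simp: inj_on_def h_def Q_def)
    then have "card (Q \<pi>) = card (h ` Q \<pi>)" by (simp add: card_image)
    also have "\<dots> \<le> card S"
    proof (rule card_cyc_arcs_le[where N = N])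
      fix p k assume "(p, k) \<in> h ` Q \<pi>"
      then show "p < N \<and> 2 * k \<le> N" using sub by (auto simp: h_def Q_def)
    next
      fix p k q l assume "(p, k) \<in> h ` Q \<pi>" "(q, l) \<in> h ` Q \<pi>"
      then obtain S T where ST': "S \<in> G" "T \<in> G" "hits \<pi> p S" "hits \<pi> q T" "k = card S" "l = card T"
        by (auto simp: h_def Q_def)
      then have ST: "S \<in> G" "T \<in> G" "\<pi> ` cyc_arc N p k = S" "\<pi> ` cyc_arc N q l = T"
        by (simp_all only: hits_def)
      show "cyc_arc N p k \<inter> cyc_arc N q l \<noteq> {}"
        using int[OF ST(1,2)] image_Int[OF inj, of "cyc_arc N p k" "cyc_arc N q l"] unfolding ST(3,4) by blast
    next
      fix p k q l assume *: "(p, k) \<in> h ` Q \<pi>" "(q, l) \<in> h ` Q \<pi>" and le: "cyc_arc N p k \<subseteq> cyc_arc N q l"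
      then obtain S T where ST': "S \<in> G" "T \<in> G" "hits \<pi> p S" "hits \<pi> q T"
        "k = card S" "l = card T" "p < N" "q < N"
        by (auto simp: h_def Q_def)
      then have ST: "S \<in> G" "T \<in> G" "\<pi> ` cyc_arc N p k = S" "\<pi> ` cyc_arc N q l = T"
        "k = card S" "l = card T" "p < N" "q < N"
        by (simp_all only: hits_def)
      have "S = T" using anti[OF ST(1,2)] image_mono[OF le, of \<pi>] unfolding ST(3,4) by blast
      then have kl: "k = l" using ST(5,6) by simp
      have "cyc_arc N p k = cyc_arc N q k"
        using ST(3,4) \<open>S = T\<close> kl inj_image_eq_iff[OF inj] by metis
      then have "p = q" using cyc_arc_start_inj[of N p k q] ST(5,7,8) sub[OF ST(1)] pos[OF ST(1)] by simp
      then show "(p, k) = (q, l)" using kl by simp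
    next
      show "(p, card S) \<in> h ` Q \<pi>" using pS by (force simp: h_def)
    qed
    finally show ?thesis .
  qed
  have posQ: "card S > 0" if "(p, S) \<in> Q \<pi>" for \<pi> p S
    using that pos by (auto simp: Q_def)
  define w where "w \<pi> = (\<Sum>(p, S)\<in>Q \<pi>. 1 / real (card S))" for \<pi>
  have w_le: "w \<pi> \<le> 1" if "\<pi> \<in> Perm" for \<pi>
  proof (cases "Q \<pi> = {}")
    case False
    then have c0: "card (Q \<pi>) > 0" using finQ by (simp add: card_gt_0_iff)
    have "w \<pi> \<le> (\<Sum>(p, S)\<in>Q \<pi>. 1 / real (card (Q \<pi>)))"
      unfolding w_def using cardQ[OF that] c0
      by (intro sum_mono) (auto intro!: divide_left_mono mult_pos_pos dest: posQ)
    also have "\<dots> = 1" using c0 by (simp add: case_prod_unfold)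
    finally show ?thesis .
  qed (simp add: w_def)
  have w_less: "w \<pi> < 1" if "\<pi> \<in> Perm" "(p, S) \<in> Q \<pi>" "(q, T) \<in> Q \<pi>" "card S < card T" for \<pi> p q S T
  proof -
    have c0: "card (Q \<pi>) > 0" using finQ that by (auto simp: card_gt_0_iff)
    have "w \<pi> < (\<Sum>(p, S)\<in>Q \<pi>. 1 / real (card (Q \<pi>)))"
      unfolding w_def 
    proof (rule sum_strict_mono_ex1[OF finQ])
      show "\<forall>x\<in>Q \<pi>. (case x of (p, S) \<Rightarrow> 1 / real (card S)) \<le> (case x of (p, S) \<Rightarrow> 1 / real (card (Q \<pi>)))"
        using cardQ[OF that(1)] c0
        by (auto intro!: divide_left_mono mult_pos_pos dest: posQ)
      have "card (Q \<pi>) < card T" using cardQ[OF that(1,2)] that(4) by simp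
      then show "\<exists>x\<in>Q \<pi>. (case x of (p, S) \<Rightarrow> 1 / real (card S)) < (case x of (p, S) \<Rightarrow> 1 / real (card (Q \<pi>)))"
        using c0 that(3) by (intro bexI[of _ "(q, T)"]) (auto intro!: divide_strict_left_mono mult_pos_pos)
    qed
    also have "\<dots> = 1" using c0 by (simp add: case_prod_unfold)
    finally show ?thesis .
  qed
  have total: "(\<Sum>\<pi>\<in>Perm. w \<pi>) = fact N * (\<Sum>S\<in>G. 1 / real ((N - 1) choose (card S - 1)))"
  proof -
    have "w \<pi> = (\<Sum>S\<in>G. \<Sum>p<N. of_bool (hits \<pi> p S) / real (card S))" for \<pi>
    proof -
      have "w \<pi> = (\<Sum>(p, S)\<in>{..<N} \<times> G. of_bool (hits \<pi> p S) / real (card S))"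
        unfolding w_def by (rule sum.mono_neutral_cong_left) (auto simp: Q_def finG)
      also have "\<dots> = (\<Sum>p<N. \<Sum>S\<in>G. of_bool (hits \<pi> p S) / real (card S))"
        by (simp add: sum.cartesian_product)
      finally show ?thesis by (subst sum.swap) 
    qed
    then have "(\<Sum>\<pi>\<in>Perm. w \<pi>) = 
      (\<Sum>\<pi>\<in>Perm. \<Sum>S\<in>G. \<Sum>p<N. of_bool (hits \<pi> p S) / real (card S))" by simp
    also have "\<dots> = (\<Sum>S\<in>G. \<Sum>p<N. \<Sum>\<pi>\<in>Perm. of_bool (hits \<pi> p S) / real (card S))"
      by (subst sum.swap, intro sum.cong refl, rule sum.swap)
    also have "\<dots> = (\<Sum>S\<in>G. fact N * (1 / real ((N - 1) choose (card S - 1))))"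
    proof (rule sum.cong[OF refl])
      fix S assume S: "S \<in> G"
      have k: "card S > 0" "2 * card S \<le> N" using pos S sub by auto
      have cnt: "(\<Sum>\<pi>\<in>Perm. of_bool (hits \<pi> p S) / real (card S)) =
          fact N / real (N choose card S) / real (card S)" if "p < N" for p
      proof -
        have "real (card {\<pi>. \<pi> permutes {..<N} \<and> hits \<pi> p S}) * real (N choose card S) = fact N"
          using card_permutes_image[of "{..<N}" "cyc_arc N p (card S)" S] cyc_arc_subset card_cyc_arc[OF that, of "card S"] sub[OF S]
          by (simp add: hits_def flip: of_nat_mult)
        moreover have "real (N choose card S) > 0" using k by simp
        ultimately have "real (card {\<pi>. \<pi> permutes {..<N} \<and> hits \<pi> p S}) = fact N / real (N choose card S)"
          by (simp add: field_simps)
        moreover have "(\<Sum>\<pi>\<in>Perm. of_bool (hits \<pi> p S)) =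
           real (card {\<pi>. \<pi> permutes {..<N} \<and> hits \<pi> p S})"
          using finP by (simp add: Perm_def of_bool_def sum.If_cases Int_def)
        ultimately show ?thesis by (simp flip: sum_divide_distrib)
      qed
      have "card S * (N choose card S) = N * ((N - 1) choose (card S - 1))"
        using k times_binomial_minus1_eq[of "card S" N] by simp
      then have "real (card S) * real (N choose card S) = real N * real ((N - 1) choose (card S - 1))"
        by (metis of_nat_mult)
      moreover have "real ((N - 1) choose (card S - 1)) > 0" using k by simp
      moreover have "real (N choose card S) > 0" using k by simp
      ultimately show "(\<Sum>p<N. \<Sum>\<pi>\<in>Perm. of_bool (hits \<pi> p S) / real (card S)) =
          fact N * (1 / real ((N - 1) choose (card S - 1)))"
        using k by (simp add: cnt field_simps)
    qed
    finally show ?thesis by (simp add: sum_distrib_left)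
  qed
  have cP: "(\<Sum>\<pi>\<in>Perm. 1) = (fact N :: real)"
    using card_permutations[of "{..<N}" N] by (simp add: Perm_def)
  have "(\<Sum>\<pi>\<in>Perm. w \<pi>) \<le> (\<Sum>\<pi>\<in>Perm. 1)" using w_le by (rule sum_mono)
  then show "(\<Sum>S\<in>G. 1 / real ((N - 1) choose (card S - 1))) \<le> 1"
    unfolding total cP by simp
  show "card S = card T" if eq: "(\<Sum>S\<in>G. 1 / real ((N - 1) choose (card S - 1))) = 1"
    and ST: "S \<in> G" "T \<in> G" for S T
  proof -
    have False if ST: "S \<in> G" "T \<in> G" and less: "card S < card T" for S T
    proof -
      \<comment> \<open>With this start the arcs from 0 and from \<open>p\<close> overlap in exactly
        as many points as \<open>S\<close> and \<open>T\<close> do, and neither wraps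
        around.\<close>
      define p where "p = card (S - T)"
      have fi: "finite S" "finite T" using finS ST by auto
      have cS: "card (S \<inter> T) + p = card S" unfolding p_def
        using fi card_Diff_subset_Int[of S T] card_mono[OF fi(1), of "S \<inter> T"] by simp
      have le: "2 * card S \<le> N" "2 * card T \<le> N" using sub ST by auto
      have pN: "p + card T \<le> N" "p < N" using cS le less by auto
      have 1: "cyc_arc N 0 (card S) = {..<card S}" "cyc_arc N p (card T) = {p..<p + card T}"
        using le pN by (auto simp: cyc_arc_def)
      have "{..<card S} \<inter> {p..<p + card T} = {p..<card S}" using cS less by auto
      then have "card (cyc_arc N 0 (card S) \<inter> cyc_arc N p (card T)) = card (S \<inter> T)"
        unfolding 1 using cS by simp
      then obtain \<pi> where \<pi>: "\<pi> permutes {..<N}" "\<pi> ` cyc_arc N 0 (card S) = S" "\<pi> ` cyc_arc N p (card T) = T"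
        using exists_permutes_image2[of "{..<N}" "cyc_arc N 0 (card S)" "cyc_arc N p (card T)" S T]
          cyc_arc_subset sub[OF ST(1)] sub[OF ST(2)] card_cyc_arc[of 0 N "card S"] card_cyc_arc[of p N "card T"] pN
        by auto
      have P: "\<pi> \<in> Perm" using \<pi> by (simp add: Perm_def)
      have "(0, S) \<in> Q \<pi>" "(p, T) \<in> Q \<pi>"
        using \<pi>(2,3) ST pN by (simp_all add: Q_def hits_def)
      then have "w \<pi> < 1" by (rule w_less[OF P _ _ less])
      then have "(\<Sum>\<pi>\<in>Perm. w \<pi>) < (\<Sum>\<pi>\<in>Perm. 1)"
        using w_le P by (intro sum_strict_mono_ex1 finP) auto
      then show False unfolding total cP eq by simp
    qed
    then show ?thesis using ST by (meson nat_neq_iff)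
  qed
qed

subsection \<open>Leading monomials in the exterior algebra\<close>

text \<open>A function on sets of indices stands for an element of the exterior algebra: its value
  at a finite \<open>S\<close> is the coefficient of the monomial with factors from \<open>S\<close>
  in increasing order. \<open>esgn j S\<close> is the sign of moving a left factor \<open>j\<close>
  to its sorted place.\<close>

definition esgn :: "nat \<Rightarrow> nat set \<Rightarrow> real" where
  "esgn j S = (- 1) ^ card {i\<in>S. i < j}"

definition lmul :: "(nat \<Rightarrow> real) \<Rightarrow> (nat set \<Rightarrow> real) \<Rightarrow> nat set \<Rightarrow> real" where
  "lmul v f S = (\<Sum>j\<in>S. esgn j S * v j * f (S - {j}))"

abbreviation lmuls :: "(nat \<Rightarrow> real) list \<Rightarrow> (nat set \<Rightarrow> real) \<Rightarrow> nat set \<Rightarrow> real" where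
  "lmuls vs f \<equiv> foldr lmul vs f"

definition one_form :: "nat set \<Rightarrow> real" where
  "one_form S = of_bool (S = {})"

text \<open>The exterior product: the product of signs counts the pairs from \<open>S\<close> and
  \<open>U - S\<close> that are out of order.\<close>

definition wedge :: "(nat set \<Rightarrow> real) \<Rightarrow> (nat set \<Rightarrow> real) \<Rightarrow> nat set \<Rightarrow> real" where
  "wedge f g U = (\<Sum>S\<in>Pow U. f S * (\<Prod>s\<in>S. esgn s (U - S)) * g (U - S))"

lemma esgn_nonzero [simp]: "esgn j S \<noteq> 0"
  by (simp add: esgn_def)

lemma lmul_cong: "(\<And>T. finite T \<Longrightarrow> f T = g T) \<Longrightarrow> finite U \<Longrightarrow> lmul v f U = lmul v g U"
  by (simp add: lmul_def)

lemma lmul_add: "lmul v (\<lambda>S. f S + g S) = (\<lambda>S. lmul v f S + lmul v g S)"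
  by (simp add: lmul_def fun_eq_iff algebra_simps sum.distrib)

lemma lmul_scale: "lmul v (\<lambda>S. c * f S) = (\<lambda>S. c * lmul v f S)"
  by (simp add: lmul_def fun_eq_iff sum_distrib_left mult_ac)

lemma lmul_zero [simp]: "lmul v (\<lambda>_. 0) = (\<lambda>_. 0)"
  by (simp add: lmul_def fun_eq_iff)

lemma lmul_add_vec: "lmul (\<lambda>i. v i + w i) f = (\<lambda>S. lmul v f S + lmul w f S)"
  by (simp add: lmul_def fun_eq_iff algebra_simps sum.distrib)

lemma lmul_scale_vec: "lmul (\<lambda>i. c * v i) f = (\<lambda>S. c * lmul v f S)"
  by (simp add: lmul_def fun_eq_iff sum_distrib_left mult_ac)

lemma lmuls_add: "lmuls vs (\<lambda>S. f S + g S) = (\<lambda>S. lmuls vs f S + lmuls vs g S)"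
  by (induction vs) (simp_all add: lmul_add)

lemma lmuls_scale: "lmuls vs (\<lambda>S. c * f S) = (\<lambda>S. c * lmuls vs f S)"
  by (induction vs) (simp_all add: lmul_scale)

lemma lmuls_zero [simp]: "lmuls vs (\<lambda>_. 0) = (\<lambda>_. 0)"
  by (induction vs) simp_all

text \<open>Removing the smaller index lowers the count below the larger one by 1, while removing
  the larger leaves the other count unchanged.\<close>

lemma esgn_swap:
  assumes "finite S" "i \<in> S" "j \<in> S" "i \<noteq> j"
  shows "esgn j S * esgn i (S - {j}) = - (esgn i S * esgn j (S - {i}))"
proof -
  have *: "esgn j S * esgn i (S - {j}) = - (esgn i S * esgn j (S - {i}))"
    if "i < j" "i \<in> S" for i j
  proof -
    have "{x\<in>S - {j}. x < i} = {x\<in>S. x < i}" using that by auto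
    moreover have "{x\<in>S. x < j} = insert i {x\<in>S - {i}. x < j}" using that by auto
    moreover have "card (insert i {x\<in>S - {i}. x < j}) = Suc (card {x\<in>S - {i}. x < j})"
      using assms(1) by (intro card_insert_disjoint) auto
    ultimately show ?thesis by (simp add: esgn_def)
  qed
  show ?thesis
    using *[of i j] *[of j i] assms by (cases "i < j") auto
qed

lemma lmul_anticommute: "lmul v (lmul w f) = (\<lambda>S. - lmul w (lmul v f) S)"
proof
  fix S :: "nat set"
  show "lmul v (lmul w f) S = - lmul w (lmul v f) S"
  proof (cases "finite S")
    case True
    have D: "{i\<in>S. i \<noteq> j} = S - {j}" "{i\<in>S. j \<noteq> i} = S - {j}" for j by auto
    have swap: "(\<Sum>j\<in>S. \<Sum>i\<in>S - {j}. g j i) = (\<Sum>i\<in>S. \<Sum>j\<in>S - {i}. g j i)" for g :: "nat \<Rightarrow> nat \<Rightarrow> real"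
      using sum.swap_restrict[OF True True, of g "\<lambda>j i. i \<noteq> j"] by (simp only: D)
    define g where "g j i = esgn j S * v j * (esgn i (S - {j}) * w i * f (S - {j} - {i}))" for j i
    define h where "h i j = esgn i S * w i * (esgn j (S - {i}) * v j * f (S - {i} - {j}))" for i j
    have gh: "g j i = - h i j" if "i \<in> S" "j \<in> S - {i}" for i j
    proof -
      have e: "esgn j S * esgn i (S - {j}) = - (esgn i S * esgn j (S - {i}))"
        by (rule esgn_swap[OF True]) (use that in auto)
      have d: "S - {j} - {i} = S - {i} - {j}" by auto
      have "g j i = (esgn j S * esgn i (S - {j})) * (v j * w i * f (S - {i} - {j}))"
        unfolding g_def d by (simp only: mult_ac)
      then show ?thesis
        unfolding e h_def by (simp add: mult_ac)
    qed
    have "lmul v (lmul w f) S = (\<Sum>j\<in>S. \<Sum>i\<in>S - {j}. g j i)"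
      by (simp add: lmul_def sum_distrib_left g_def)
    also have "\<dots> = (\<Sum>i\<in>S. \<Sum>j\<in>S - {i}. g j i)"
      by (rule swap)
    also have "\<dots> = (\<Sum>i\<in>S. \<Sum>j\<in>S - {i}. - h i j)"
      using gh by (intro sum.cong refl)
    also have "\<dots> = - lmul w (lmul v f) S"
      by (simp add: lmul_def sum_distrib_left sum_negf h_def)
    finally show ?thesis .
  qed (simp add: lmul_def)
qed

lemma lmul_same: "lmul v (lmul v f) = (\<lambda>_. 0)"
proof
  show "lmul v (lmul v f) S = 0" for S
    using fun_cong[OF lmul_anticommute[of v v f], of S] by linarith
qed

lemma lmuls_lmul: "lmuls us (lmul v h) = (\<lambda>S. (- 1) ^ length us * lmul v (lmuls us h) S)"
proof (induction us)
  case (Cons u us)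
  have "lmuls (u # us) (lmul v h) = (\<lambda>S. (- 1) ^ length us * lmul u (lmul v (lmuls us h)) S)"
    by (simp add: Cons lmul_scale)
  then show ?case by (simp add: lmul_anticommute[of u v])
qed simp

lemma lmuls_one_infinite: "infinite S \<Longrightarrow> lmuls vs one_form S = 0"
  by (cases vs) (auto simp: one_form_def lmul_def)

section \<open>The exterior product of two forms\<close>

lemma wedge_add: "wedge (\<lambda>S. f S + g S) h U = wedge f h U + wedge g h U"
  by (simp add: wedge_def algebra_simps sum.distrib)

lemma wedge_scale: "wedge (\<lambda>S. c * f S) h U = c * wedge f h U"
  by (simp add: wedge_def sum_distrib_left mult_ac)

lemma wedge_zero: "wedge (\<lambda>_. 0) h U = 0"
  by (simp add: wedge_def)

text \<open>Associativity with a vector as first factor. Both sides sum over an index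
  \<open>j\<close> and a splitting of the rest of \<open>U\<close>, and the signs agree because
  \<open>esgn j\<close> is multiplicative over the disjoint parts \<open>S\<close> and
  \<open>U - S\<close>.\<close>

lemma wedge_lmul: "wedge (lmul v f) g U = lmul v (wedge f g) U"
proof (cases "finite U")
  case fin: True
  have "wedge (lmul v f) g U = (\<Sum>S\<in>Pow U. \<Sum>j\<in>S.
      esgn j S * v j * f (S - {j}) * (\<Prod>s\<in>S. esgn s (U - S)) * g (U - S))"
    by (simp add: wedge_def lmul_def sum_distrib_right)
  also have "\<dots> = (\<Sum>(S, j)\<in>Sigma (Pow U) (\<lambda>S. S).
      esgn j S * v j * f (S - {j}) * (\<Prod>s\<in>S. esgn s (U - S)) * g (U - S))"
    using fin by (intro sum.Sigma) (auto intro: finite_subset)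
  also have "\<dots> = (\<Sum>(j, S)\<in>Sigma U (\<lambda>j. Pow (U - {j})).
      esgn j U * v j * (f S * (\<Prod>s\<in>S. esgn s (U - {j} - S)) * g (U - {j} - S)))"
  proof (rule sum.reindex_bij_witness[where i = "\<lambda>(j, S). (insert j S, j)" and j = "\<lambda>(S, j). (j, S - {j})"])
    fix x assume "x \<in> Sigma (Pow U) (\<lambda>S. S)"
    then obtain S j where x: "x = (S, j)" "S \<subseteq> U" "j \<in> S" by auto
    define T where "T = U - S"
    have fS: "finite S" "finite T" using fin x finite_subset by (auto simp: T_def)
    have T: "U - {j} - (S - {j}) = T" using x by (auto simp: T_def)
    have "{i\<in>U. i < j} = {i\<in>S. i < j} \<union> {i\<in>T. i < j}" using x by (auto simp: T_def)
    moreover have "card ({i\<in>S. i < j} \<union> {i\<in>T. i < j}) = card {i\<in>S. i < j} + card {i\<in>T. i < j}"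
      using fS by (intro card_Un_disjoint) (auto simp: T_def)
    ultimately have e: "esgn j U = esgn j S * esgn j T"
      by (simp add: esgn_def power_add)
    have p: "(\<Prod>s\<in>S. esgn s T) = esgn j T * (\<Prod>s\<in>S - {j}. esgn s T)"
      using fS x by (simp add: prod.remove)
    show "(case case x of (S, j) \<Rightarrow> (j, S - {j}) of (j, S) \<Rightarrow>
        esgn j U * v j * (f S * (\<Prod>s\<in>S. esgn s (U - {j} - S)) * g (U - {j} - S))) =
      (case x of (S, j) \<Rightarrow> esgn j S * v j * f (S - {j}) * (\<Prod>s\<in>S. esgn s (U - S)) * g (U - S))"
      by (simp only: x prod.case T T_def[symmetric] e p mult_ac)
  qed auto
  also have "\<dots> = lmul v (wedge f g) U"
    using fin by (simp add: wedge_def lmul_def sum_distrib_left sum.Sigma)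
  finally show ?thesis .
qed (simp add: wedge_def lmul_def)

lemma wedge_lmuls: "finite U \<Longrightarrow> wedge (lmuls us one_form) h U = lmuls us h U"
proof (induction us arbitrary: U)
  case Nil
  have "wedge one_form h U = (\<Sum>S\<in>{{}}. one_form S * (\<Prod>s\<in>S. esgn s (U - S)) * h (U - S))"
    unfolding wedge_def using Nil by (intro sum.mono_neutral_right) (auto simp: one_form_def)
  also have "\<dots> = h U" by (simp add: one_form_def)
  finally show ?case by simp
next
  case (Cons u us)
  then show ?case by (simp add: wedge_lmul cong: lmul_cong)
qed

section \<open>Homogeneous forms, ideals and leading monomials\<close>

definition homog :: "nat \<Rightarrow> nat \<Rightarrow> (nat set \<Rightarrow> real) \<Rightarrow> bool" where
  "homog N k f \<longleftrightarrow> (\<forall>S. f S \<noteq> 0 \<longrightarrow> S \<subseteq> {..<N} \<and> card S = k)"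

lemma homog_add:
  assumes "homog N k f" "homog N k g"
  shows "homog N k (\<lambda>S. f S + g S)"
  unfolding homog_def
proof (intro allI impI)
  fix S assume "f S + g S \<noteq> 0"
  then have "f S \<noteq> 0 \<or> g S \<noteq> 0" by auto
  then show "S \<subseteq> {..<N} \<and> card S = k" using assms unfolding homog_def by blast
qed

lemma homog_lmul:
  assumes "homog N k f" "\<forall>i\<ge>N. v i = 0"
  shows "homog N (Suc k) (lmul v f)"
  unfolding homog_def
proof (intro allI impI)
  fix S assume nz: "lmul v f S \<noteq> 0"
  then have "finite S" by (auto simp: lmul_def intro: ccontr)
  from nz obtain j where "j \<in> S" "esgn j S * v j * f (S - {j}) \<noteq> 0"
    unfolding lmul_def by (rule sum.not_neutral_contains_not_neutral)
  then have j: "j \<in> S" "v j \<noteq> 0" "f (S - {j}) \<noteq> 0" by auto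
  have "j < N" using assms(2) j(2) by (meson not_less)
  then show "S \<subseteq> {..<N} \<and> card S = Suc k"
    using assms(1) j \<open>finite S\<close> card.remove[of S j] by (auto simp: homog_def)
qed

lemma homog_lmuls: "(\<And>v. v \<in> set vs \<Longrightarrow> \<forall>i\<ge>N. v i = 0) \<Longrightarrow> homog N (length vs) (lmuls vs one_form)"
proof (induction vs)
  case (Cons v vs)
  then show ?case by (simp add: homog_lmul)
qed (simp add: homog_def one_form_def)

text \<open>The homogeneous component of degree \<open>k\<close> of the ideal generated by the forms in \<open>G\<close>,
  each of which carries its degree.\<close>

inductive ideal :: "nat \<Rightarrow> (nat \<times> (nat set \<Rightarrow> real)) set \<Rightarrow> nat \<Rightarrow> (nat set \<Rightarrow> real) \<Rightarrow> bool"
  for N G where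
  zero: "ideal N G k (\<lambda>_. 0)"
| gen: "(k, g) \<in> G \<Longrightarrow> ideal N G k g"
| add: "ideal N G k f \<Longrightarrow> ideal N G k g \<Longrightarrow> ideal N G k (\<lambda>S. f S + g S)"
| scale: "ideal N G k f \<Longrightarrow> ideal N G k (\<lambda>S. c * f S)"
| mult: "\<forall>i\<ge>N. v i = 0 \<Longrightarrow> ideal N G k f \<Longrightarrow> ideal N G (Suc k) (lmul v f)"

lemma ideal_homog:
  assumes "ideal N G k f" "\<And>k g. (k, g) \<in> G \<Longrightarrow> homog N k g"
  shows "homog N k f"
  using assms
proof induction
  case (add k f g)
  then show ?case by (simp add: homog_add)
next
  case (mult v k f)
  then show ?case by (simp add: homog_lmul)
next
  case (scale k f c)
  then have "homog N k f" by blast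
  then show ?case by (simp add: homog_def)
qed (simp_all add: homog_def)

lemma ideal_mono:
  assumes "ideal N G k f" "G \<subseteq> H"
  shows "ideal N H k f"
  using assms by induction (auto intro: ideal.intros)

text \<open>By associativity, the forms whose product with \<open>h\<close> vanishes are closed
  under multiplication by vectors from the left, so it suffices to test generators.\<close>

lemma ideal_wedge_zero:
  assumes "ideal N G k f" "\<And>k g U. (k, g) \<in> G \<Longrightarrow> finite U \<Longrightarrow> wedge g h U = 0" "finite U"
  shows "wedge f h U = 0"
  using assms
proof (induction arbitrary: U)
  case (mult v k f)
  then show ?case by (simp add: wedge_lmul) (simp add: lmul_def)
qed (auto simp: wedge_add wedge_scale wedge_zero)

text \<open>A new vector factor can be moved to the front of \<open>us\<close> at the cost of a
  sign, so a word that kills the generators kills the ideal.\<close>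

lemma ideal_lmuls_zero:
  assumes "ideal N G k f" "\<And>k g. (k, g) \<in> G \<Longrightarrow> lmuls us g = (\<lambda>_. 0)"
  shows "lmuls us f = (\<lambda>_. 0)"
  using assms by induction (auto simp: lmuls_add lmuls_scale lmuls_lmul)

text \<open>Monomials are ordered by \<^const>\<open>set_encode\<close>, a strict total order that is additive on disjoint
  unions and therefore compatible with multiplication.\<close>

definition is_lead :: "(nat set \<Rightarrow> real) \<Rightarrow> nat set \<Rightarrow> bool" where
  "is_lead f S \<longleftrightarrow> f S \<noteq> 0 \<and> (\<forall>T. f T \<noteq> 0 \<longrightarrow> set_encode T \<le> set_encode S)"

lemma homog_lead_exists:
  assumes "homog N k f" "f \<noteq> (\<lambda>_. 0)"
  shows "\<exists>S. is_lead f S"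
proof -
  have "{S. f S \<noteq> 0} \<subseteq> Pow {..<N}" using assms(1) by (auto simp: homog_def)
  then have "finite {S. f S \<noteq> 0}" by (rule finite_subset) simp
  moreover have "{S. f S \<noteq> 0} \<noteq> {}" using assms(2) by auto
  ultimately have "Max (set_encode ` {S. f S \<noteq> 0}) \<in> set_encode ` {S. f S \<noteq> 0}"
    by (intro Max_in) auto
  then obtain S where S: "f S \<noteq> 0" "Max (set_encode ` {S. f S \<noteq> 0}) = set_encode S" by auto
  have "set_encode T \<le> set_encode S" if "f T \<noteq> 0" for T
    using \<open>finite {S. f S \<noteq> 0}\<close> that by (simp flip: S(2))
  then show ?thesis using S(1) by (auto simp: is_lead_def)
qed

lemma set_encode_Un: "finite S \<Longrightarrow> finite T \<Longrightarrow> S \<inter> T = {} \<Longrightarrow> set_encode (S \<union> T) = set_encode S + set_encode T"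
  by (simp add: set_encode_def sum.union_disjoint)

text \<open>In every splitting of \<open>S \<union> T\<close> the two codes have the same sum. A
  nonzero term bounds both by the codes of \<open>S\<close> and \<open>T\<close>, so only the
  splitting into \<open>S\<close> and \<open>T\<close> survives and nothing can cancel it.\<close>

lemma wedge_lead:
  assumes f: "is_lead f S" and g: "is_lead g T" and fin: "finite S" "finite T" and disj: "S \<inter> T = {}"
  shows "wedge f g (S \<union> T) \<noteq> 0"
proof -
  have other: "f S' = 0 \<or> g (S \<union> T - S') = 0" if S': "S' \<subseteq> S \<union> T" "S' \<noteq> S" for S'
  proof (rule ccontr)
    assume nz: "\<not> ?thesis"
    have fin': "finite S'" "finite (S \<union> T - S')" using S' fin finite_subset by auto
    have "set_encode S' + set_encode (S \<union> T - S') = set_encode (S' \<union> (S \<union> T - S'))"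
      using fin' by (intro set_encode_Un[symmetric]) auto
    also have "S' \<union> (S \<union> T - S') = S \<union> T" using S' by auto
    also have "set_encode (S \<union> T) = set_encode S + set_encode T"
      using fin disj by (rule set_encode_Un)
    finally have sum: "set_encode S' + set_encode (S \<union> T - S') = set_encode S + set_encode T" .
    have "set_encode S' \<le> set_encode S" "set_encode (S \<union> T - S') \<le> set_encode T"
      using nz f g by (simp_all add: is_lead_def)
    with sum have "set_encode S' = set_encode S" by linarith
    then show False using set_encode_eq fin fin' S'(2) by blast
  qed
  have "wedge f g (S \<union> T) = (\<Sum>S'\<in>{S}. f S' * (\<Prod>s\<in>S'. esgn s (S \<union> T - S')) * g (S \<union> T - S'))"
    unfolding wedge_def using fin other by (intro sum.mono_neutral_right) auto
  moreover have "S \<union> T - S = T" using disj by auto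
  ultimately show ?thesis using f g fin by (simp add: is_lead_def prod_zero_iff)
qed

text \<open>Multiplying by the basis vector \<open>j\<close> inserts \<open>j\<close> into each
  monomial without it, which raises the code by \<open>2 ^ j\<close>, and kills the other
  monomials.\<close>

lemma lmul_unit_lead:
  assumes f: "is_lead f S" and fin: "\<And>T. f T \<noteq> 0 \<Longrightarrow> finite T" and j: "j \<notin> S"
  shows "is_lead (lmul (\<lambda>i. of_bool (i = j)) f) (insert j S)"
proof -
  have eq: "lmul (\<lambda>i. of_bool (i = j)) f T = (if j \<in> T then esgn j T * f (T - {j}) else 0)" if "finite T" for T
  proof -
    have "lmul (\<lambda>i. of_bool (i = j)) f T = (\<Sum>i\<in>T. if i = j then esgn j T * f (T - {j}) else 0)"
      unfolding lmul_def by (rule sum.cong) auto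
    then show ?thesis using that by simp
  qed
  have finS: "finite S" using f fin by (auto simp: is_lead_def)
  show ?thesis unfolding is_lead_def
  proof (intro conjI allI impI)
    show "lmul (\<lambda>i. of_bool (i = j)) f (insert j S) \<noteq> 0"
      using eq[of "insert j S"] finS j f by (simp add: is_lead_def)
  next
    fix T assume nz: "lmul (\<lambda>i. of_bool (i = j)) f T \<noteq> 0"
    then have "finite T" by (auto simp: lmul_def intro: ccontr)
    with nz eq[of T] have T: "j \<in> T" "f (T - {j}) \<noteq> 0" by (auto split: if_splits)
    have "set_encode T = 2 ^ j + set_encode (T - {j})"
      using set_encode_insert[of "T - {j}" j] \<open>finite T\<close> T(1) by (simp add: insert_absorb)
    also have "\<dots> \<le> 2 ^ j + set_encode S" using f T(2) by (simp add: is_lead_def)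
    also have "\<dots> = set_encode (insert j S)" using finS j by simp
    finally show "set_encode T \<le> set_encode (insert j S)" .
  qed
qed

text \<open>Multiply by the missing basis vectors one at a time. Leading sets of an ideal thus form
  an up-set, so a set that is not leading contains no leading set.\<close>

lemma ideal_lead_superset:
  assumes G: "\<And>k g. (k, g) \<in> G \<Longrightarrow> homog N k g" and f: "ideal N G k f" "is_lead f S"
    and T: "S \<subseteq> T" "T \<subseteq> {..<N}"
  shows "\<exists>h. ideal N G (card T) h \<and> is_lead h T"
proof -
  have "finite T" using T(2) finite_subset by blast
  have k: "card S = k" using ideal_homog[OF f(1) G] f(2) by (auto simp: homog_def is_lead_def)
  have "\<exists>h. ideal N G (card (S \<union> D)) h \<and> is_lead h (S \<union> D)" if "finite D" "D \<subseteq> {..<N} - S" for D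
    using that
  proof induction
    case empty
    then show ?case using f k by auto
  next
    case (insert j D)
    then obtain h where h: "ideal N G (card (S \<union> D)) h" "is_lead h (S \<union> D)" by auto
    have "finite S" using T \<open>finite T\<close> finite_subset by blast
    have "ideal N G (Suc (card (S \<union> D))) (lmul (\<lambda>i. of_bool (i = j)) h)"
      using insert.prems by (intro ideal.mult h) auto
    moreover have "is_lead (lmul (\<lambda>i. of_bool (i = j)) h) (insert j (S \<union> D))"
      using insert ideal_homog[OF h(1) G]
      by (intro lmul_unit_lead h) (auto simp: homog_def intro: finite_subset[of _ "{..<N}"])
    moreover have "Suc (card (S \<union> D)) = card (S \<union> insert j D)"
      using insert \<open>finite S\<close> by simp
    ultimately show ?case by auto
  qed
  from this[of "T - S"] show ?thesis
    using T \<open>finite T\<close> by (auto simp: Un_absorb1)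
qed

text \<open>The form of least leading set in the coset of \<open>\<alpha>\<close> modulo the ideal has a leading set
  outside the leading sets of the ideal, since otherwise it could be reduced further.\<close>

lemma coset_new_lead:
  assumes G: "\<And>k g. (k, g) \<in> G \<Longrightarrow> homog N k g" and \<alpha>: "homog N k \<alpha>" "\<not> ideal N G k \<alpha>"
  obtains x S where "ideal N G k x" "is_lead (\<lambda>T. \<alpha> T + x T) S" "\<And>h. ideal N G k h \<Longrightarrow> \<not> is_lead h S"
proof -
  have lead: "\<exists>S. is_lead (\<lambda>T. \<alpha> T + x T) S" if x: "ideal N G k x" for x
  proof (rule homog_lead_exists)
    show "homog N k (\<lambda>T. \<alpha> T + x T)"
      using \<alpha>(1) ideal_homog[OF x G] by (rule homog_add)
    show "(\<lambda>T. \<alpha> T + x T) \<noteq> (\<lambda>_. 0)"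
    proof
      assume "(\<lambda>T. \<alpha> T + x T) = (\<lambda>_. 0)"
      then have "\<alpha> = (\<lambda>T. - 1 * x T)" by (auto simp: fun_eq_iff add_eq_0_iff2)
      then show False using ideal.scale[OF x, of "- 1"] \<alpha>(2) by simp
    qed
  qed
  define P where "P = (\<lambda>(x, S). ideal N G k x \<and> is_lead (\<lambda>T. \<alpha> T + x T) S)"
  have "\<exists>y. P y" using lead[OF ideal.zero] ideal.zero[of N G k] unfolding P_def by fast
  then obtain y where y: "P y" "\<And>z. P z \<Longrightarrow> set_encode (snd y) \<le> set_encode (snd z)"
    using ex_has_least_nat[of P _ "\<lambda>z. set_encode (snd z)"] by blast
  obtain x S where xS: "y = (x, S)" by fastforce
  have x: "ideal N G k x" and S: "is_lead (\<lambda>T. \<alpha> T + x T) S" using y(1) by (simp_all add: P_def xS)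
  have "\<not> is_lead h S" if h: "ideal N G k h" for h
  proof
    assume hS: "is_lead h S"
    \<comment> \<open>This multiple of \<open>h\<close> cancels the coefficient at \<open>S\<close>,
      which makes the leading set drop strictly.\<close>
    define c where "c = - (\<alpha> S + x S) / h S"
    define x' where "x' T = x T + c * h T" for T
    have x': "ideal N G k x'" unfolding x'_def by (intro ideal.add ideal.scale x h)
    then obtain S' where S': "is_lead (\<lambda>T. \<alpha> T + x' T) S'" using lead by blast
    then have "P (x', S')" using x' by (simp add: P_def)
    then have le: "set_encode S \<le> set_encode S'" using y(2) xS by force
    have "\<alpha> S + x' S = 0" using hS by (simp add: x'_def c_def is_lead_def)
    then have "S' \<noteq> S" using S' by (auto simp: is_lead_def)
    moreover have "\<alpha> S' + x S' \<noteq> 0 \<or> h S' \<noteq> 0"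
      using S' by (auto simp: is_lead_def x'_def)
    then have "set_encode S' \<le> set_encode S" using S hS by (auto simp: is_lead_def)
    moreover have "finite S'" "finite S"
    proof -
      have "finite T" if "homog N k f" "f T \<noteq> 0" for f T
        using that finite_subset[of T "{..<N}"] by (auto simp: homog_def)
      then show "finite S'" "finite S"
        using \<open>\<alpha> S' + x S' \<noteq> 0 \<or> h S' \<noteq> 0\<close> hS ideal_homog[OF h G]
          homog_add[OF \<alpha>(1) ideal_homog[OF x G]] unfolding is_lead_def by blast+
    qed
    ultimately show False using le set_encode_eq by (metis le_antisym)
  qed
  then show thesis using that x S by blast
qed

text \<open>\<open>S i\<close> is a leading set of the ideal of the first \<open>i\<close> words,
  but not, in its degree, of the ideal of the first \<open>i - 1\<close>. As leading sets form an
  up-set, \<open>S i\<close> contains no earlier one. All products of two elements of the full ideal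
  vanish, so no two leading sets are disjoint.\<close>

theorem words_leading_sets:
  fixes U V :: "nat \<Rightarrow> (nat \<Rightarrow> real) list" and m N :: nat
  assumes supp: "\<And>i v. i \<in> {1..m} \<Longrightarrow> v \<in> set (U i) \<Longrightarrow> \<forall>j\<ge>N. v j = 0"
    and UU: "\<And>i j. i \<in> {1..m} \<Longrightarrow> j \<in> {1..m} \<Longrightarrow> lmuls (U i @ U j) one_form = (\<lambda>_. 0)"
    and UV: "\<And>i j. i \<in> {1..m} \<Longrightarrow> j \<in> {1..m} \<Longrightarrow> i < j \<Longrightarrow> lmuls (U i @ V j) one_form = (\<lambda>_. 0)"
    and diag: "\<And>i. i \<in> {1..m} \<Longrightarrow> lmuls (U i @ V i) one_form \<noteq> (\<lambda>_. 0)"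
  obtains S where "\<And>i. i \<in> {1..m} \<Longrightarrow> S i \<subseteq> {..<N} \<and> card (S i) = length (U i)"
    and "\<And>i j. i \<in> {1..m} \<Longrightarrow> j \<in> {1..m} \<Longrightarrow> S i \<inter> S j \<noteq> {}"
    and "\<And>i j. i \<in> {1..m} \<Longrightarrow> j \<in> {1..m} \<Longrightarrow> i < j \<Longrightarrow> \<not> S i \<subseteq> S j"
proof -
  define \<alpha> where "\<alpha> i = lmuls (U i) one_form" for i
  \<comment> \<open>Only the words before \<open>i\<close> generate, so the \<open>i\<close>-th one
    first enters in \<open>G (Suc i)\<close>.\<close>
  define G where "G i = (\<lambda>j. (length (U j), \<alpha> j)) ` {1..<i}" for i :: nat
  have \<alpha>h: "homog N (length (U i)) (\<alpha> i)" if "i \<in> {1..m}" for i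
    unfolding \<alpha>_def using supp that by (intro homog_lmuls) auto
  have Gh: "homog N k g" if "(k, g) \<in> G i" "i \<le> Suc m" for i k g
    using that \<alpha>h by (auto simp: G_def)
  have "\<exists>f S. ideal N (G (Suc i)) (length (U i)) f \<and> is_lead f S \<and>
      (\<forall>h. ideal N (G i) (length (U i)) h \<longrightarrow> \<not> is_lead h S)" if i: "i \<in> {1..m}" for i
  proof -
    \<comment> \<open>Right multiplication by the word \<open>V i\<close> kills all predecessors,
      hence their ideal, but does not kill the word \<open>U i\<close>.\<close>
    have "\<not> ideal N (G i) (length (U i)) (\<alpha> i)"
    proof
      assume id: "ideal N (G i) (length (U i)) (\<alpha> i)"
      have zero: "wedge g (lmuls (V i) one_form) T = 0" if "(k, g) \<in> G i" "finite T" for k g T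
        using that UV i by (auto simp: G_def \<alpha>_def wedge_lmuls)
      have "lmuls (U i @ V i) one_form T = 0" for T
      proof (cases "finite T")
        case True
        then show ?thesis using ideal_wedge_zero[OF id zero True] by (simp add: \<alpha>_def wedge_lmuls)
      qed (rule lmuls_one_infinite)
      then show False using diag[OF i] by auto
    qed
    moreover have "homog N k g" if "(k, g) \<in> G i" for k g using Gh that i by auto
    ultimately obtain x S where xS: "ideal N (G i) (length (U i)) x" "is_lead (\<lambda>T. \<alpha> i T + x T) S"
      "\<And>h. ideal N (G i) (length (U i)) h \<Longrightarrow> \<not> is_lead h S"
      using coset_new_lead[OF _ \<alpha>h[OF i], of "G i"] by blast
    have sub: "G i \<subseteq> G (Suc i)" by (auto simp: G_def)
    have mem: "(length (U i), \<alpha> i) \<in> G (Suc i)" using i by (auto simp: G_def)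
    have "ideal N (G (Suc i)) (length (U i)) (\<lambda>T. \<alpha> i T + x T)"
      by (intro ideal.add ideal.gen[OF mem] ideal_mono[OF xS(1) sub])
    then show ?thesis using xS by blast
  qed
  then obtain f S where fS: "\<And>i. i \<in> {1..m} \<Longrightarrow> ideal N (G (Suc i)) (length (U i)) (f i)"
    "\<And>i. i \<in> {1..m} \<Longrightarrow> is_lead (f i) (S i)"
    "\<And>i h. i \<in> {1..m} \<Longrightarrow> ideal N (G i) (length (U i)) h \<Longrightarrow> \<not> is_lead h (S i)"
    by metis
  have S: "S i \<subseteq> {..<N} \<and> card (S i) = length (U i)" if "i \<in> {1..m}" for i
  proof -
    have "homog N (length (U i)) (f i)"
      by (rule ideal_homog[OF fS(1)[OF that]]) (use Gh that in auto)
    then show ?thesis using fS(2)[OF that] by (auto simp: homog_def is_lead_def)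
  qed
  have finS: "finite (S i)" if "i \<in> {1..m}" for i using S[OF that] finite_subset by blast
  have mono: "ideal N (G j) k g" if "ideal N (G i) k g" "i \<le> j" for i j k g
    using that(1) by (rule ideal_mono) (use that(2) in \<open>auto simp: G_def\<close>)
  show thesis
  proof (rule that[of S])
    fix i j assume ij: "i \<in> {1..m}" "j \<in> {1..m}"
    have f1: "ideal N (G (Suc m)) (length (U i)) (f i)" "ideal N (G (Suc m)) (length (U j)) (f j)"
      using ij by (auto intro!: mono[OF fS(1)])
    show "S i \<inter> S j \<noteq> {}"
    proof
      assume "S i \<inter> S j = {}"
      then have "wedge (f i) (f j) (S i \<union> S j) \<noteq> 0"
        using ij by (intro wedge_lead fS finS)
      moreover have "wedge (f i) (f j) (S i \<union> S j) = 0"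
      proof (rule ideal_wedge_zero[OF f1(1)])
        fix k g T assume g: "(k, g) \<in> G (Suc m)" and T: "finite (T :: nat set)"
        then obtain l where l: "l \<in> {1..m}" "g = \<alpha> l" unfolding G_def by fastforce
        \<comment> \<open>The vanishing spreads in two stages: each word \<open>U l\<close> kills
          all generators and therefore \<open>f j\<close>; then \<open>f j\<close> is killed by all
          generators and therefore by \<open>f i\<close>.\<close>
        have "lmuls (U l) (f j) = (\<lambda>_. 0)"
          using UU l(1) by (intro ideal_lmuls_zero[OF f1(2)]) (auto simp: G_def \<alpha>_def)
        then show "wedge g (f j) T = 0" by (simp add: l(2) \<alpha>_def wedge_lmuls T)
      qed (use finS ij in auto)
      ultimately show False by simp
    qed
  next
    fix i j assume ij: "i \<in> {1..m}" "j \<in> {1..m}" "i < j"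
    show "\<not> S i \<subseteq> S j"
    proof
      assume le: "S i \<subseteq> S j"
      have "ideal N (G j) (length (U i)) (f i)" using ij by (intro mono[OF fS(1)]) auto
      moreover have "homog N k g" if "(k, g) \<in> G j" for k g using Gh that ij by auto
      ultimately obtain h where "ideal N (G j) (card (S j)) h" "is_lead h (S j)"
        using ideal_lead_superset[of "G j" N "length (U i)" "f i" "S i" "S j"] fS(2)[OF ij(1)] le S[OF ij(2)] by auto
      then show False using fS(3)[OF ij(2)] S[OF ij(2)] by auto
    qed
  qed (use S in auto)
qed

subsection \<open>Generic functionals\<close>

lemma lmuls_mset:
  assumes "mset vs = mset ws"
  shows "\<exists>c. lmuls ws h = (\<lambda>S. c * lmuls vs h S)"
  using assms
proof (induction vs arbitrary: ws)
  case Nil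
  then show ?case by (intro exI[of _ 1]) simp
next
  case (Cons v vs)
  then have "v \<in> set ws" by (metis list.set_intros(1) mset_eq_setD)
  then obtain p q where ws: "ws = p @ v # q" by (meson split_list)
  then have "mset vs = mset (p @ q)" using Cons.prems by simp
  then obtain c where c: "lmuls (p @ q) h = (\<lambda>S. c * lmuls vs h S)" using Cons.IH by blast
  have "lmuls ws h = (\<lambda>S. (- 1) ^ length p * lmul v (lmuls (p @ q) h) S)"
    by (simp add: ws lmuls_lmul)
  also have "\<dots> = (\<lambda>S. ((- 1) ^ length p * c) * lmuls (v # vs) h S)"
    unfolding c by (simp add: lmul_scale mult.assoc)
  finally show ?case by blast
qed

lemma lmuls_repeated:
  assumes "\<not> distinct vs"
  shows "lmuls vs h = (\<lambda>_. 0)"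
  using assms
proof (induction vs)
  case (Cons v vs)
  show ?case
  proof (cases "v \<in> set vs")
    case True
    then obtain p q where "vs = p @ v # q" by (meson split_list)
    then show ?thesis by (simp add: lmuls_lmul lmul_scale lmul_same)
  next
    case False
    then show ?thesis using Cons by simp
  qed
qed simp

text \<open>A linear map into coordinate sequences, possibly with a kernel; it is later given by
  finitely many generic functionals.\<close>

locale coordinates =
  fixes \<phi> :: "'a::real_vector \<Rightarrow> nat \<Rightarrow> real"
  assumes linear_coord: "linear (\<lambda>x. \<phi> x j)"
begin

lemma coord_add: "\<phi> (x + y) = (\<lambda>j. \<phi> x j + \<phi> y j)"
  using linear_add[OF linear_coord] by (auto simp: fun_eq_iff)

lemma coord_scale: "\<phi> (c *\<^sub>R x) = (\<lambda>j. c * \<phi> x j)"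
  using linear_cmul[OF linear_coord] by (auto simp: fun_eq_iff)

lemma coord_zero: "\<phi> 0 = (\<lambda>j. 0)"
  using linear_0[OF linear_coord] by (auto simp: fun_eq_iff)

lemma lmul_coord_zero: "lmul (\<phi> 0) h = (\<lambda>_. 0)"
  by (simp add: coord_zero lmul_def fun_eq_iff)

text \<open>Split \<open>x\<close> into a multiple of \<open>u\<close>, killed by the factor
  \<open>u\<close>, and a vector in the span of the remaining factors, which reaches them by
  anticommuting with \<open>u\<close>.\<close>

lemma lmul_span_zero:
  "x \<in> span (set us) \<Longrightarrow> lmul (\<phi> x) (lmuls (map \<phi> us) h) = (\<lambda>_. 0)"
proof (induction us arbitrary: x)
  case Nil
  then show ?case by (simp add: lmul_coord_zero)
next
  case (Cons u us)
  then obtain k where k: "x - k *\<^sub>R u \<in> span (set us)"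
    by (auto simp: span_breakdown_eq)
  define y where "y = x - k *\<^sub>R u"
  have x: "\<phi> x = (\<lambda>j. \<phi> y j + k * \<phi> u j)"
    using coord_add[of y "k *\<^sub>R u"] by (simp add: y_def coord_scale)
  have "lmul (\<phi> y) (lmul (\<phi> u) (lmuls (map \<phi> us) h)) = (\<lambda>_. 0)"
    unfolding lmul_anticommute[of "\<phi> y"] using Cons.IH[OF k[folded y_def]] by simp
  then show ?case
    by (simp add: x lmul_add_vec lmul_scale_vec lmul_same)
qed

text \<open>An exchange argument: at the factor \<open>u\<close> where \<open>x\<close> enters the
  span, \<open>u\<close> is a combination of \<open>x\<close>, which can be moved through to
  \<open>h\<close>, and of a vector spanned by the factors after it. A common nonzero vector of two
  subspaces thus makes the product of their words vanish.\<close>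

lemma lmuls_common_zero:
  assumes "lmul (\<phi> x) h = (\<lambda>_. 0)" "x \<in> span (set us)" "x \<noteq> 0"
  shows "lmuls (map \<phi> us) h = (\<lambda>_. 0)"
  using assms(2)
proof (induction us)
  case Nil
  then show ?case using assms(3) by simp
next
  case (Cons u us)
  show ?case
  proof (cases "x \<in> span (set us)")
    case True
    then show ?thesis using Cons by simp
  next
    case False
    from Cons.prems obtain k where k: "x - k *\<^sub>R u \<in> span (set us)"
      by (auto simp: span_breakdown_eq)
    have "k \<noteq> 0" using k False by auto
    define y where "y = x - k *\<^sub>R u"
    have "u = (1 / k) *\<^sub>R (x + (-1) *\<^sub>R y)" using \<open>k \<noteq> 0\<close> by (simp add: y_def)
    then have u: "\<phi> u = (\<lambda>j. (1 / k) * (\<phi> x j + (-1) * \<phi> y j))"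
      by (metis coord_add coord_scale)
    have "lmul (\<phi> y) (lmuls (map \<phi> us) h) = (\<lambda>_. 0)"
      using k by (simp add: y_def lmul_span_zero)
    moreover have "lmul (\<phi> x) (lmuls (map \<phi> us) h) = (\<lambda>_. 0)"
    proof -
      have "(\<lambda>S. (- 1) ^ length us * lmul (\<phi> x) (lmuls (map \<phi> us) h) S) = (\<lambda>_. 0)"
        using lmuls_lmul[of "map \<phi> us" "\<phi> x" h] assms(1) by simp
      then show ?thesis by (simp add: fun_eq_iff)
    qed
    ultimately have "lmul (\<lambda>j. (1 / k) * (\<phi> x j + (-1) * \<phi> y j)) (lmuls (map \<phi> us) h) = (\<lambda>_. 0)"
      unfolding lmul_scale_vec lmul_add_vec by simp
    then show ?thesis by (simp add: u)
  qed
qed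

text \<open>The vectors that make the product vanish in one given slot form a subspace, so each slot
  extends from \<open>B\<close> to its span. The prefix \<open>ps\<close> holds the entries kept
  fixed while later slots are treated.\<close>

lemma lmuls_multilinear_zero:
  assumes "\<And>ys. set ys \<subseteq> B \<Longrightarrow> length ys = n \<Longrightarrow> lmuls (map \<phi> (ps @ ys)) h = (\<lambda>_. 0)"
    and "set xs \<subseteq> span B" "length xs = n"
  shows "lmuls (map \<phi> (ps @ xs)) h = (\<lambda>_. 0)"
  using assms
proof (induction n arbitrary: ps xs)
  case (Suc n)
  from Suc.prems(3) obtain x xs' where xs: "xs = x # xs'" "length xs' = n" by (cases xs) auto
  define Z where "Z = lmuls (map \<phi> xs') h"
  have "lmuls (map \<phi> ps) (lmul (\<phi> y) Z) = (\<lambda>_. 0)" if "y \<in> B" for y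
  proof -
    have "lmuls (map \<phi> ((ps @ [y]) @ xs')) h = (\<lambda>_. 0)"
    proof (rule Suc.IH)
      fix ys assume "set ys \<subseteq> B" "length ys = n"
      then show "lmuls (map \<phi> ((ps @ [y]) @ ys)) h = (\<lambda>_. 0)"
        using Suc.prems(1)[of "y # ys"] that by simp
    qed (use Suc.prems(2) xs in auto)
    then show ?thesis by (simp add: Z_def)
  qed
  moreover have "subspace {y. lmuls (map \<phi> ps) (lmul (\<phi> y) Z) = (\<lambda>_. 0)}"
    by (rule subspaceI) (simp_all add: lmul_coord_zero coord_add coord_scale lmul_add_vec
        lmul_scale_vec lmuls_add lmuls_scale)
  moreover have "x \<in> span B" using Suc.prems(2) xs by simp
  ultimately have "lmuls (map \<phi> ps) (lmul (\<phi> x) Z) = (\<lambda>_. 0)"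
    using span_induct[of x B "\<lambda>y. lmuls (map \<phi> ps) (lmul (\<phi> y) Z) = (\<lambda>_. 0)"] by blast
  then show ?case by (simp add: xs Z_def)
qed simp

text \<open>The vanishing form of the determinant rule: by multilinearity only words in
  \<open>us\<close> matter, and such a word is a rearrangement of \<open>us\<close> or repeats a
  factor.\<close>

lemma lmuls_spanning_zero:
  assumes zero: "lmuls (map \<phi> us) h = (\<lambda>_. 0)" and "distinct us"
    and xs: "set xs \<subseteq> span (set us)" "length xs = length us"
  shows "lmuls (map \<phi> xs) h = (\<lambda>_. 0)"
proof -
  have "lmuls (map \<phi> ([] @ xs)) h = (\<lambda>_. 0)"
  proof (rule lmuls_multilinear_zero[OF _ xs])
    fix ys assume ys: "set ys \<subseteq> set us" "length ys = length us"
    show "lmuls (map \<phi> ([] @ ys)) h = (\<lambda>_. 0)"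
    proof (cases "distinct ys")
      case True
      have "set ys = set us"
        using ys True \<open>distinct us\<close> by (intro card_subset_eq) (simp_all add: distinct_card)
      then have "mset (map \<phi> us) = mset (map \<phi> ys)"
        using True \<open>distinct us\<close> by (metis mset_map set_eq_iff_mset_eq_distinct)
      then obtain c where "lmuls (map \<phi> ys) h = (\<lambda>S. c * lmuls (map \<phi> us) h S)"
        using lmuls_mset by blast
      then show ?thesis using zero by simp
    next
      case False
      then have "\<not> distinct (map \<phi> ys)" by (simp add: distinct_map)
      then show ?thesis using lmuls_repeated by simp
    qed
  qed
  then show ?thesis by simp
qed

text \<open>A triangular determinant, expanded from the last row upwards. The support bound makes
  the induction work: for the coefficient at \<open>{k..<N}\<close>, any choice of \<open>j\<close>
  other than \<open>k\<close> leaves \<open>k\<close> in a set where the remaining product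
  vanishes.\<close>

lemma lmuls_triangular:
  assumes supp: "\<And>x j. N \<le> j \<Longrightarrow> \<phi> x j = 0"
    and below: "\<And>k j. k < N \<Longrightarrow> j < k \<Longrightarrow> \<phi> (x k) j = 0"
    and diag: "\<And>k. k < N \<Longrightarrow> \<phi> (x k) k \<noteq> 0"
    and "k \<le> N"
  shows "lmuls (map (\<lambda>i. \<phi> (x i)) [k..<N]) one_form {k..<N} \<noteq> 0 \<and>
    (\<forall>T. lmuls (map (\<lambda>i. \<phi> (x i)) [k..<N]) one_form T \<noteq> 0 \<longrightarrow> T \<subseteq> {k..<N})"
  using \<open>k \<le> N\<close>
proof (induction k rule: inc_induct)
  case base
  then show ?case by (simp add: one_form_def)
next
  case (step k)
  define W where "W = lmuls (map (\<lambda>i. \<phi> (x i)) [Suc k..<N]) one_form"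
  have W: "W {Suc k..<N} \<noteq> 0" "\<And>T. W T \<noteq> 0 \<Longrightarrow> T \<subseteq> {Suc k..<N}"
    using step.IH by (simp_all add: W_def)
  have up: "lmuls (map (\<lambda>i. \<phi> (x i)) [k..<N]) one_form = lmul (\<phi> (x k)) W"
    using step.hyps by (simp add: W_def upt_conv_Cons)
  have "lmul (\<phi> (x k)) W {k..<N} = (\<Sum>j\<in>{k}. esgn j {k..<N} * \<phi> (x k) j * W ({k..<N} - {j}))"
    unfolding lmul_def
  proof (rule sum.mono_neutral_right)
    show "\<forall>j\<in>{k..<N} - {k}. esgn j {k..<N} * \<phi> (x k) j * W ({k..<N} - {j}) = 0"
    proof
      fix j assume "j \<in> {k..<N} - {k}"
      then have "k \<in> {k..<N} - {j}" by auto
      then have "\<not> {k..<N} - {j} \<subseteq> {Suc k..<N}" by (metis Suc_n_not_le_n atLeastLessThan_iff subsetD)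
      then show "esgn j {k..<N} * \<phi> (x k) j * W ({k..<N} - {j}) = 0" using W(2) by auto
    qed
  qed (use step.hyps in auto)
  moreover have "{k..<N} - {k} = {Suc k..<N}" by auto
  ultimately have "lmul (\<phi> (x k)) W {k..<N} \<noteq> 0"
    using diag[of k] step.hyps W(1) by simp
  moreover have "T \<subseteq> {k..<N}" if nz: "lmul (\<phi> (x k)) W T \<noteq> 0" for T
  proof -
    from nz obtain j where "j \<in> T" "esgn j T * \<phi> (x k) j * W (T - {j}) \<noteq> 0"
      unfolding lmul_def by (rule sum.not_neutral_contains_not_neutral)
    then have j: "j \<in> T" "\<phi> (x k) j \<noteq> 0" "T - {j} \<subseteq> {Suc k..<N}" using W(2) by auto
    have "k \<le> j" "j < N" using below[of k j] supp[of j] step.hyps j(2) by (meson not_le)+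
    then show ?thesis using j(3) by fastforce
  qed
  ultimately show ?case unfolding up by blast
qed

end

section \<open>Functionals in general position\<close>

lemma exists_functional_nonzero:
  fixes Z :: "'a::real_vector set"
  assumes "finite Z" "0 \<notin> Z"
  shows "\<exists>f :: 'a \<Rightarrow> real. linear f \<and> (\<forall>z\<in>Z. f z \<noteq> 0)"
  using assms
proof (induction Z)
  case empty
  show ?case by (intro exI[of _ "\<lambda>_. 0"]) (simp add: linear_zero)
next
  case (insert z Z)
  then obtain f :: "'a \<Rightarrow> real" where f: "linear f" "\<forall>y\<in>Z. f y \<noteq> 0" by auto
  have "independent {z}" using insert.prems by simp
  then obtain g :: "'a \<Rightarrow> real" where g: "linear g" "g z = 1"
    using linear_independent_extend[of "{z}" "\<lambda>_. 1 :: real"] by auto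
  \<comment> \<open>Each vector on which \<open>g\<close> does not vanish rules out one multiplier
    \<open>c\<close>; the others are in \<open>Z\<close>, where \<open>f\<close> alone is
    nonzero.\<close>
  have "finite ((\<lambda>y. - f y / g y) ` insert z Z)" using insert.hyps by simp
  then obtain c where c: "c \<notin> (\<lambda>y. - f y / g y) ` insert z Z"
    using ex_new_if_finite[OF infinite_UNIV_char_0] by blast
  have "f y + c * g y \<noteq> 0" if y: "y \<in> insert z Z" for y
  proof (cases "g y = 0")
    case True
    then show ?thesis using y f(2) g(2) by auto
  next
    case False
    have "c \<noteq> - f y / g y" using c y by blast
    then show ?thesis using False by (auto simp: field_simps)
  qed
  moreover have "linear (\<lambda>y. f y + c * g y)"
    using linear_compose_add[OF f(1) linear_compose_scale_right[OF g(1), of c]] by simp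
  ultimately show ?case by blast
qed

locale finite_dim_real =
  fixes E :: "'a::real_vector set"
  assumes finite_dim: "finite_dimensional_vector_space (scaleR :: real \<Rightarrow> 'a \<Rightarrow> 'a) E"

text \<open>The rewrites identify the constants of the abstract vector space with those of the type
  class, so that the dimension facts apply to them directly.\<close>

sublocale finite_dim_real \<subseteq> fin: finite_dimensional_vector_space "scaleR :: real \<Rightarrow> 'a \<Rightarrow> 'a" E
  rewrites "module.dependent (*\<^sub>R) = (dependent :: 'a set \<Rightarrow> bool)"
    and "module.subspace (*\<^sub>R) = (subspace :: 'a set \<Rightarrow> bool)"
    and "module.span (*\<^sub>R) = (span :: 'a set \<Rightarrow> 'a set)"
    and "vector_space.dim (*\<^sub>R) = (dim :: 'a set \<Rightarrow> nat)"
  using finite_dim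
  by (simp_all add: dependent_raw_def subspace_raw_def span_raw_def dim_raw_def)

context finite_dim_real
begin

lemma dim_Int_kernel:
  fixes X :: "'a set" and f :: "'a \<Rightarrow> real"
  assumes X: "subspace X" and f: "linear f" and z: "z \<in> X" "f z \<noteq> 0"
  shows "dim X = Suc (dim (X \<inter> {x. f x = 0}))"
proof -
  define Y where "Y = X \<inter> {x. f x = 0}"
  have Y: "subspace Y"
    unfolding Y_def using X f
    by (auto simp: subspace_def linear_0 linear_add linear_cmul)
  have "z \<notin> span Y" using Y z(2) by (simp add: span_eq_iff[THEN iffD2] Y_def)
  have "X \<subseteq> span (insert z Y)"
  proof
    fix x assume x: "x \<in> X"
    have "x - (f x / f z) *\<^sub>R z \<in> Y"
      using x z X f by (simp add: Y_def subspace_diff subspace_scale linear_diff linear_cmul)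
    then show "x \<in> span (insert z Y)"
      unfolding span_breakdown_eq using span_base by blast
  qed
  moreover have "span (insert z Y) \<subseteq> X"
    using X z(1) by (intro span_minimal) (auto simp: Y_def)
  ultimately have "dim X = dim (span (insert z Y))" by (metis subset_antisym)
  then show ?thesis
    using fin.dim_insert[of z Y] \<open>z \<notin> span Y\<close> by (simp add: Y_def)
qed

text \<open>Choose the functionals one by one, each nonzero at some vector of every intersection
  that is still nontrivial, so that it lowers that dimension by 1. Truncated subtraction covers the
  intersections that are already zero. All \<open>k\<close> up to \<open>n\<close> are recorded
  because the successive drops are used later.\<close>

lemma generic_functionals:
  fixes \<X> :: "'a set set"
  assumes fin: "finite \<X>" and sub: "\<And>X. X \<in> \<X> \<Longrightarrow> subspace X"
  shows "\<exists>F :: nat \<Rightarrow> 'a \<Rightarrow> real. (\<forall>j. linear (F j)) \<and>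
    (\<forall>X\<in>\<X>. \<forall>k\<le>n. dim (X \<inter> {x. \<forall>j<k. F j x = 0}) = dim X - k)"
proof (induction n)
  case 0
  show ?case by (intro exI[of _ "\<lambda>_ _. 0"]) (simp add: linear_zero)
next
  case (Suc n)
  then obtain F :: "nat \<Rightarrow> 'a \<Rightarrow> real" where F: "\<And>j. linear (F j)"
    and dimF: "\<And>X k. X \<in> \<X> \<Longrightarrow> k \<le> n \<Longrightarrow> dim (X \<inter> {x. \<forall>j<k. F j x = 0}) = dim X - k"
    by blast
  define K where "K = {x. \<forall>j<n. F j x = 0}"
  have "subspace K"
    using F by (auto simp: subspace_def K_def linear_0 linear_add linear_cmul)
  then have XK: "subspace (X \<inter> K)" if "X \<in> \<X>" for X
    using sub[OF that] by (simp add: subspace_inter)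
  define \<Y> where "\<Y> = {X\<in>\<X>. \<exists>z\<in>X \<inter> K. z \<noteq> 0}"
  have "\<forall>X\<in>\<Y>. \<exists>z. z \<in> X \<inter> K \<and> z \<noteq> 0" by (auto simp: \<Y>_def)
  then obtain z where z: "\<And>X. X \<in> \<Y> \<Longrightarrow> z X \<in> X \<inter> K \<and> z X \<noteq> 0" by metis
  have "finite (z ` \<Y>)" using fin by (simp add: \<Y>_def)
  moreover have "0 \<notin> z ` \<Y>" using z by fastforce
  ultimately obtain f :: "'a \<Rightarrow> real" where f: "linear f" "\<And>X. X \<in> \<Y> \<Longrightarrow> f (z X) \<noteq> 0"
    using exists_functional_nonzero[of "z ` \<Y>"] by auto
  define F' where "F' = F(n := f)"
  have "dim (X \<inter> {x. \<forall>j<k. F' j x = 0}) = dim X - k" if X: "X \<in> \<X>" and k: "k \<le> Suc n" for X k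
  proof (cases "k = Suc n")
    case False
    then have "{x. \<forall>j<k. F' j x = 0} = {x. \<forall>j<k. F j x = 0}" using k by (auto simp: F'_def)
    then show ?thesis using dimF[OF X, of k] False k by simp
  next
    case True
    have eq: "X \<inter> {x. \<forall>j<k. F' j x = 0} = (X \<inter> K) \<inter> {x. f x = 0}"
      using True by (auto simp: F'_def K_def less_Suc_eq)
    have d: "dim (X \<inter> K) = dim X - n" using dimF[OF X order.refl] by (simp add: K_def)
    show ?thesis
    proof (cases "X \<in> \<Y>")
      case True
      then show ?thesis
        using dim_Int_kernel[OF XK[OF X] f(1), of "z X"] z[OF True] f(2)[OF True] d eq \<open>k = Suc n\<close>
        by simp
    next
      case False
      then have "X \<inter> K \<subseteq> {0}" using X by (auto simp: \<Y>_def)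
      then have "dim (X \<inter> K) = 0" "dim (X \<inter> K \<inter> {x. f x = 0}) = 0" by (auto simp: fin.dim_eq_0)
      then show ?thesis using d eq \<open>k = Suc n\<close> by simp
    qed
  qed
  moreover have "linear (F' j)" for j using F f by (simp add: F'_def)
  ultimately show ?case by blast
qed

text \<open>Each further functional makes the dimension drop, which yields vectors of the span on
  which the functionals form a triangular matrix. Their product is nonzero, hence so is that of
  \<open>us\<close>, whose span contains them.\<close>

lemma lmuls_generic_nonzero:
  fixes F :: "nat \<Rightarrow> 'a \<Rightarrow> real" and us :: "'a list"
  assumes F: "\<And>j. linear (F j)" and N: "length us = N" "dim (span (set us)) = N"
    and gen: "\<And>k. k \<le> N \<Longrightarrow> dim (span (set us) \<inter> {x. \<forall>j<k. F j x = 0}) = N - k"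
  shows "lmuls (map (\<lambda>x j. if j < N then F j x else 0) us) one_form \<noteq> (\<lambda>_. 0)"
proof -
  define \<phi> where "\<phi> x j = (if j < N then F j x else 0)" for x j
  have "linear (\<lambda>x. \<phi> x j)" for j
    using F[of j] by (cases "j < N") (simp_all add: \<phi>_def linear_zero)
  then interpret coordinates \<phi> by (rule coordinates.intro)
  have "card (set us) = length us"
    using N fin.dim_le_card[of "span (set us)" "set us"] card_length[of us] by simp
  then have "distinct us" by (rule card_distinct)
  have "\<exists>x. x \<in> span (set us) \<and> (\<forall>j<k. F j x = 0) \<and> F k x \<noteq> 0" if "k < N" for k
  proof (rule ccontr)
    assume "\<not> ?thesis"
    then have "span (set us) \<inter> {x. \<forall>j<k. F j x = 0} = span (set us) \<inter> {x. \<forall>j<Suc k. F j x = 0}"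
      by (auto simp: less_Suc_eq)
    then show False using gen[of k] gen[of "Suc k"] that by simp
  qed
  then obtain x where x: "\<And>k. k < N \<Longrightarrow> x k \<in> span (set us) \<and> (\<forall>j<k. F j (x k) = 0) \<and> F k (x k) \<noteq> 0"
    by metis
  have "lmuls (map (\<lambda>i. \<phi> (x i)) [0..<N]) one_form {0..<N} \<noteq> 0"
    using lmuls_triangular[of N x 0] x by (auto simp: \<phi>_def)
  then have "lmuls (map \<phi> (map x [0..<N])) one_form \<noteq> (\<lambda>_. 0)" by (auto simp: comp_def)
  moreover have "set (map x [0..<N]) \<subseteq> span (set us)" using x by auto
  ultimately have "lmuls (map \<phi> us) one_form \<noteq> (\<lambda>_. 0)"
    using lmuls_spanning_zero[of us one_form "map x [0..<N]"] \<open>distinct us\<close> N(1) by auto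
  then show ?thesis by (simp add: \<phi>_def[abs_def])
qed

end

section \<open>Reduction to generic position and transfer to sets\<close>

theorem theorem1p4:
  fixes A B :: "nat \<Rightarrow> 'a::real_vector set"
    and E :: "'a set"
    and a b :: "nat \<Rightarrow> nat"
    and m t N :: nat
  assumes fin_dim: "finite_dimensional_vector_space (scaleR :: real \<Rightarrow> 'a \<Rightarrow> 'a) E"
    and m_pos: "m \<ge> 1"
    and N_pos: "N \<ge> 1"
    and subspace_A: "\<And>i. i \<in> {1..m} \<Longrightarrow> subspace (A i)"
    and subspace_B: "\<And>i. i \<in> {1..m} \<Longrightarrow> subspace (B i)"
    and dim_A: "\<And>i. i \<in> {1..m} \<Longrightarrow> dim (A i) = a i"
    and dim_B: "\<And>i. i \<in> {1..m} \<Longrightarrow> dim (B i) = b i"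
    and a_le_b: "\<And>i. i \<in> {1..m} \<Longrightarrow> a i \<le> b i"
    and AA: "\<And>i j. i \<in> {1..m} \<Longrightarrow> j \<in> {1..m} \<Longrightarrow> dim (A i \<inter> A j) > t"
    and AB_diag: "\<And>i. i \<in> {1..m} \<Longrightarrow> dim (A i \<inter> B i) \<le> t"
    and AB_skew: "\<And>i j. i \<in> {1..m} \<Longrightarrow> j \<in> {1..m} \<Longrightarrow> i < j \<Longrightarrow> dim (A i \<inter> B j) > t"
    and a_plus_b: "\<And>i. i \<in> {1..m} \<Longrightarrow> a i + b i = N"
    and a_mono: "\<And>i j. i \<in> {1..m} \<Longrightarrow> j \<in> {1..m} \<Longrightarrow> i \<le> j \<Longrightarrow> a i \<le> a j"
  shows "(\<Sum>i=1..m. inverse (real ((N - (2 * t + 1)) choose (a i - (t + 1))))) \<le> 1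
    \<and> ((\<forall>i\<in>{1..m}. a i < b i) \<longrightarrow>
        (\<Sum>i=1..m. inverse (real ((N - (2 * t + 1)) choose (a i - (t + 1))))) = 1 \<longrightarrow>
        (\<forall>i\<in>{1..m}. \<forall>j\<in>{1..m}. a i = a j \<and> b i = b j))"
proof -
  interpret finite_dim_real E using fin_dim by (rule finite_dim_real.intro)
  define I where "I = {1..m}"
  define M where "M = N - 2 * t"
  have at: "t < a i" "a i \<le> b i" "a i + b i = N" if "i \<in> I" for i
    using AA[of i i] dim_A[of i] a_le_b[of i] a_plus_b[of i] that by (auto simp: I_def)
  have sA: "subspace (A i)" and sB: "subspace (B i)" if "i \<in> I" for i
    using subspace_A subspace_B that by (auto simp: I_def)
  \<comment> \<open>All subspaces whose dimension has to be known after cutting with the kernel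
    \<open>K\<close>: dimensions above \<open>t\<close> stay positive, those at most
    \<open>t\<close> become 0.\<close>
  define \<X> where "\<X> = A ` I \<union> B ` I \<union> (\<lambda>i. A i \<inter> B i) ` I \<union>
    (\<lambda>(i, j). A i \<inter> A j) ` (I \<times> I) \<union> (\<lambda>(i, j). A i \<inter> B j) ` (I \<times> I)"
  have "finite \<X>" by (simp add: \<X>_def I_def)
  moreover have "subspace X" if "X \<in> \<X>" for X
    using that sA sB by (auto simp: \<X>_def subspace_inter)
  ultimately obtain F :: "nat \<Rightarrow> 'a \<Rightarrow> real" where F: "\<And>j. linear (F j)"
    "\<And>X. X \<in> \<X> \<Longrightarrow> dim (X \<inter> {x. \<forall>j<t. F j x = 0}) = dim X - t"
    using generic_functionals[of \<X> t] by blast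
  define K where "K = {x. \<forall>j<t. F j x = 0}"
  have "subspace K"
    using F(1) by (auto simp: subspace_def K_def linear_0 linear_add linear_cmul)
  define A' where "A' i = A i \<inter> K" for i
  define B' where "B' i = B i \<inter> K" for i
  have sA': "subspace (A' i)" and sB': "subspace (B' i)" if "i \<in> I" for i
    using that sA sB \<open>subspace K\<close> by (auto simp: A'_def B'_def subspace_inter)
  have dA': "dim (A' i) = a i - t" and dB': "dim (B' i) = b i - t" if "i \<in> I" for i
    using F(2)[of "A i"] F(2)[of "B i"] that dim_A dim_B
    by (auto simp: A'_def B'_def K_def \<X>_def I_def)
  have nz: "\<exists>x\<in>X. x \<noteq> 0" if "dim X > 0" for X :: "'a set"
  proof (rule ccontr)
    assume "\<not> ?thesis"
    then have "X \<subseteq> {0}" by auto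
    then have "dim X = 0" by (rule fin.dim_eq_0[THEN iffD2])
    then show False using that by linarith
  qed
  have AA': "\<exists>x\<in>A' i \<inter> A' j. x \<noteq> 0" if "i \<in> I" "j \<in> I" for i j
  proof -
    have "A' i \<inter> A' j = A i \<inter> A j \<inter> K" by (auto simp: A'_def)
    moreover have "A i \<inter> A j \<in> \<X>" using that by (auto simp: \<X>_def)
    ultimately show ?thesis
      using F(2)[of "A i \<inter> A j"] AA[of i j] that by (intro nz) (simp add: K_def I_def)
  qed
  have AB': "\<exists>x\<in>A' i \<inter> B' j. x \<noteq> 0" if "i \<in> I" "j \<in> I" "i < j" for i j
  proof -
    have "A' i \<inter> B' j = A i \<inter> B j \<inter> K" by (auto simp: A'_def B'_def)
    moreover have "A i \<inter> B j \<in> \<X>" using that by (auto simp: \<X>_def)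
    ultimately show ?thesis
      using F(2)[of "A i \<inter> B j"] AB_skew[of i j] that by (intro nz) (simp add: K_def I_def)
  qed
  have diag': "dim (A' i \<inter> B' i) = 0" if "i \<in> I" for i
  proof -
    have "A' i \<inter> B' i = A i \<inter> B i \<inter> K" by (auto simp: A'_def B'_def)
    moreover have "A i \<inter> B i \<in> \<X>" using that by (auto simp: \<X>_def)
    ultimately show ?thesis
      using F(2)[of "A i \<inter> B i"] AB_diag[of i] that by (simp add: K_def I_def)
  qed
  have basis: "\<exists>us. length us = dim V \<and> span (set us) = V" if V: "subspace V" for V :: "'a set"
  proof -
    obtain Bs where Bs: "Bs \<subseteq> V" "independent Bs" "V \<subseteq> span Bs" "card Bs = dim V"
      by (rule basis_exists[of V])
    obtain us where us: "set us = Bs" "distinct us"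
      using finite_distinct_list[OF fin.finiteI_independent[OF Bs(2)]] by blast
    have "span Bs = V" using Bs V by (meson span_minimal subset_antisym)
    moreover have "length us = card Bs" using distinct_card[OF us(2)] us(1) by simp
    ultimately show ?thesis using us Bs(4) by auto
  qed
  obtain U where U: "\<And>i. i \<in> I \<Longrightarrow> length (U i) = a i - t \<and> span (set (U i)) = A' i"
    using basis[OF sA'] dA' by metis
  obtain V where V: "\<And>i. i \<in> I \<Longrightarrow> length (V i) = b i - t \<and> span (set (V i)) = B' i"
    using basis[OF sB'] dB' by metis
  \<comment> \<open>The sum of \<open>A' i\<close> and \<open>B' i\<close> is direct, so its
    dimension is the same number \<open>M\<close> for every \<open>i\<close>.\<close>
  define C where "C i = span (set (U i @ V i))" for i
  have dC: "dim (C i) = M" if "i \<in> I" for i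
  proof -
    have "C i = {x + y |x y. x \<in> A' i \<and> y \<in> B' i}"
      using U[OF that] V[OF that] by (auto simp: C_def span_Un)
    then show ?thesis
      using fin.dim_sums_Int[OF sA'[OF that] sB'[OF that]] diag'[OF that] dA'[OF that] dB'[OF that]
        at[OF that] by (simp add: M_def)
  qed
  have "finite (C ` I)" "\<And>X. X \<in> C ` I \<Longrightarrow> subspace X" by (auto simp: I_def C_def)
  then obtain H :: "nat \<Rightarrow> 'a \<Rightarrow> real" where H: "\<And>j. linear (H j)"
    "\<And>X k. X \<in> C ` I \<Longrightarrow> k \<le> M \<Longrightarrow> dim (X \<inter> {x. \<forall>j<k. H j x = 0}) = dim X - k"
    using generic_functionals[of "C ` I" M] by blast
  \<comment> \<open>These \<open>M\<close> functionals have no common zero in any \<open>C i\<close>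
    except 0, so \<open>\<phi>\<close> is injective on each of them.\<close>
  define \<phi> where "\<phi> x j = (if j < M then H j x else 0)" for x j
  have "linear (\<lambda>x. \<phi> x j)" for j
    using H(1)[of j] by (cases "j < M") (simp_all add: \<phi>_def linear_zero)
  then interpret coordinates \<phi> by (rule coordinates.intro)
  have common: "lmuls (map \<phi> us @ map \<phi> vs) one_form = (\<lambda>_. 0)"
    if "x \<in> span (set us) \<inter> span (set vs)" "x \<noteq> 0" for us vs x
    using that lmuls_common_zero[of x "lmuls (map \<phi> vs) one_form" us] lmul_span_zero[of x vs] by simp
  obtain S where S: "\<And>i. i \<in> I \<Longrightarrow> S i \<subseteq> {..<M} \<and> card (S i) = length (map \<phi> (U i))"
    "\<And>i j. i \<in> I \<Longrightarrow> j \<in> I \<Longrightarrow> S i \<inter> S j \<noteq> {}"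
    "\<And>i j. i \<in> I \<Longrightarrow> j \<in> I \<Longrightarrow> i < j \<Longrightarrow> \<not> S i \<subseteq> S j"
  proof (rule words_leading_sets[of m "\<lambda>i. map \<phi> (U i)" M "\<lambda>i. map \<phi> (V i)", folded I_def])
    fix i v assume "i \<in> I" "v \<in> set (map \<phi> (U i))"
    then show "\<forall>j\<ge>M. v j = 0" by (auto simp: \<phi>_def)
  next
    fix i j assume "i \<in> I" "j \<in> I"
    then show "lmuls (map \<phi> (U i) @ map \<phi> (U j)) one_form = (\<lambda>_. 0)"
      using common AA' U by metis
  next
    fix i j assume "i \<in> I" "j \<in> I" "i < j"
    then show "lmuls (map \<phi> (U i) @ map \<phi> (V j)) one_form = (\<lambda>_. 0)"
      using common AB' U V by metis
  next
    fix i assume i: "i \<in> I"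
    have "lmuls (map (\<lambda>x j. if j < M then H j x else 0) (U i @ V i)) one_form \<noteq> (\<lambda>_. 0)"
    proof (rule lmuls_generic_nonzero[OF H(1)])
      show "length (U i @ V i) = M" using U[OF i] V[OF i] at[OF i] by (simp add: M_def)
    qed (use H(2)[of "C i"] dC i in \<open>auto simp: C_def\<close>)
    then show "lmuls (map \<phi> (U i) @ map \<phi> (V i)) one_form \<noteq> (\<lambda>_. 0)"
      by (simp add: \<phi>_def[abs_def])
  next
    fix S assume "\<And>i. i \<in> I \<Longrightarrow> S i \<subseteq> {..<M} \<and> card (S i) = length (map \<phi> (U i))"
      "\<And>i j. i \<in> I \<Longrightarrow> j \<in> I \<Longrightarrow> S i \<inter> S j \<noteq> {}"
      "\<And>i j. i \<in> I \<Longrightarrow> j \<in> I \<Longrightarrow> i < j \<Longrightarrow> \<not> S i \<subseteq> S j"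
    then show thesis by (rule that)
  qed
  have cS: "card (S i) = a i - t" if "i \<in> I" for i using S(1) U that by simp
  \<comment> \<open>Words exclude inclusion only of an earlier set in a later one. In the other
    direction the ordering of the \<open>a i\<close> turns an inclusion into an equality, which is
    excluded as well.\<close>
  have anti: "i = j" if ij: "i \<in> I" "j \<in> I" "S i \<subseteq> S j" for i j
  proof (rule ccontr)
    assume "i \<noteq> j"
    then have "j < i" using S(3)[of i j] ij by (meson linorder_neqE_nat)
    then have "a j \<le> a i" using a_mono[of j i] ij by (simp add: I_def)
    then have "card (S j) \<le> card (S i)" using cS ij by simp
    moreover have "finite (S j)" using S(1)[OF ij(2)] finite_subset by blast
    ultimately have "S i = S j" using ij(3) card_seteq by blast
    then show False using S(3)[OF ij(2,1) \<open>j < i\<close>] by simp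
  qed
  then have inj: "inj_on S I" by (auto intro: inj_onI)
  have sub: "X \<subseteq> {..<M} \<and> 2 * card X \<le> M" if X: "X \<in> S ` I" for X
  proof -
    obtain i where i: "i \<in> I" "X = S i" using X by blast
    have "2 * (a i - t) \<le> M" using at[OF i(1)] by (simp add: M_def)
    then show ?thesis using S(1)[OF i(1)] cS[OF i(1)] unfolding i(2) by metis
  qed
  have int: "X \<inter> Y \<noteq> {}" if "X \<in> S ` I" "Y \<in> S ` I" for X Y using that S(2) by auto
  have ant: "X = Y" if "X \<in> S ` I" "Y \<in> S ` I" "X \<subseteq> Y" for X Y using that anti by auto
  \<comment> \<open>The shifts agree: \<open>M - 1\<close> is \<open>N - (2 * t + 1)\<close>, and
    \<open>card (S i) - 1\<close> is \<open>a i - (t + 1)\<close>.\<close>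
  have sum: "(\<Sum>i=1..m. inverse (real ((N - (2 * t + 1)) choose (a i - (t + 1))))) =
      (\<Sum>X\<in>S ` I. 1 / real ((M - 1) choose (card X - 1)))"
    unfolding sum.reindex[OF inj] I_def[symmetric]
    by (intro sum.cong refl) (simp add: cS M_def divide_inverse)
  have "a i = a j \<and> b i = b j"
    if "(\<Sum>X\<in>S ` I. 1 / real ((M - 1) choose (card X - 1))) = 1" "i \<in> I" "j \<in> I" for i j
  proof -
    have "card (S i) = card (S j)"
      by (rule intersecting_antichain_sum_le(2)[OF sub int ant that(1)]) (use that in auto)
    then show ?thesis using cS at that by (metis add_diff_cancel_left' le_add_diff_inverse less_imp_le)
  qed
  moreover have "(\<Sum>X\<in>S ` I. 1 / real ((M - 1) choose (card X - 1))) \<le> 1"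
    by (rule intersecting_antichain_sum_le(1)[OF sub int ant])
  ultimately show ?thesis
    unfolding sum I_def by blast
qed

end
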